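(* Let $d\in\mathbb{N}$, $1\le p\le q\le\infty$ and let $s,s'\in\mathbb{R}$ satisfy $$-\frac dq<s'\le s<d\left(1-\frac1p\right),\qquad(\ast)$$ where the upper bound in $(\ast)$ is understood as $s\le0$ when $p=1$, and the lower bound in $(\ast)$ is understood as $0\le s'$ when $q=\infty$; in particular $(\ast)$ is understood as $s'=s=0$ when $p=1$ and $q=\infty$. Then there exists a positive constant $C$ depending on $d,p,q,s$ and $s'$ such that $$\|e^{t\Delta}f\|_{L^q_{s'}}\le C\,t^{-\frac d2\left(\frac1p-\frac1q\right)-\frac{s-s'}{2}}\|f\|_{L^p_s}$$ for all $f\in L^p_s(\mathbb{R}^d)$ and $t>0$. Moreover, condition $(\ast)$ is optimal: if it is violated, then there is no constant $C$ for which $e^{t\Delta}f$ is well defined and the inequality holds for all $f\in L^p_s(\mathbb{R}^d)$ and $t>0$.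
   Context: For $s\in\mathbb{R}$, $q\in[1,\infty]$, $L^q_s(\mathbb{R}^d)$ is the space of Lebesgue measurable $f$ on $\mathbb{R}^d$ with $\|f\|_{L^q_s}:=\||x|^sf\|_{L^q}<\infty$ (essential supremum if $q=\infty$). $e^{t\Delta}f:=g_t*f$ with $g_t(x)=(4\pi t)^{-d/2}e^{-|x|^2/(4t)}$. *)

theory Defs
  imports "HOL-Analysis.Analysis" "HOL-Probability.Essential_Supremum"
begin

text \<open>
  Exponents range over \<^typ>\<open>ennreal\<close>, with \<^term>\<open>top :: ennreal\<close> for \<open>\<infinity>\<close>. \<open>recip q\<close> is the real
  number \<open>1/q\<close>, with \<open>1/\<infinity> = 0\<close>.
\<close>

definition recip :: "ennreal \<Rightarrow> real" where
  "recip q = enn2real (1 / q)"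

text \<open>The value \<open>\<infinity>\<close> is allowed, so the norm is meaningful for every measurable function.\<close>

definition Lq_norm :: "ennreal \<Rightarrow> (real^'n \<Rightarrow> 'a::real_normed_vector) \<Rightarrow> ennreal" where
  "Lq_norm q h =
    (if q = top then esssup lebesgue (\<lambda>x. ennreal (norm (h x)))
     else let I = (\<integral>\<^sup>+ x. ennreal (norm (h x) powr enn2real q) \<partial>lebesgue)
          in if I = top then top else ennreal (enn2real I powr recip q))"

text \<open>
  \<open>0 powr s = 0\<close> for every \<open>s\<close>, so the weight \<open>|x|\<^sup>s\<close> takes the value 0 at the origin; this is
  a null set and does not affect the norm.
\<close>

definition weighted_norm :: "ennreal \<Rightarrow> real \<Rightarrow> (real^'n \<Rightarrow> 'a::real_normed_vector) \<Rightarrow> ennreal" where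
  "weighted_norm q s f = Lq_norm q (\<lambda>x. (norm x powr s) *\<^sub>R f x)"

definition weighted_L :: "ennreal \<Rightarrow> real \<Rightarrow> (real^'n \<Rightarrow> 'a::real_normed_vector) set" where
  "weighted_L q s = {f \<in> borel_measurable lebesgue. weighted_norm q s f < top}"

definition heat_kernel :: "real \<Rightarrow> real^'n \<Rightarrow> real" where
  "heat_kernel t x = (4 * pi * t) powr (- real CARD('n) / 2) * exp (- (norm x)\<^sup>2 / (4 * t))"

definition heat :: "real \<Rightarrow> (real^'n \<Rightarrow> 'a::euclidean_space) \<Rightarrow> real^'n \<Rightarrow> 'a" where
  "heat t f x = (\<integral>y. heat_kernel t (x - y) *\<^sub>R f y \<partial>lebesgue)"

text \<open>
  The Bochner integral is 0 for non-integrable functions, so \<^const>\<open>heat\<close> is total; the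
  convolution genuinely exists when its integral converges absolutely for almost every point.
\<close>

definition heat_well_defined :: "real \<Rightarrow> (real^'n \<Rightarrow> 'a::euclidean_space) \<Rightarrow> bool" where
  "heat_well_defined t f \<longleftrightarrow>
    (AE x in lebesgue. integrable lebesgue (\<lambda>y. heat_kernel t (x - y) *\<^sub>R f y))"

text \<open>
  \<open>-d/q < s' \<le> s < d (1 - 1/p)\<close>, where the upper bound reads \<open>s \<le> 0\<close> if \<open>p = 1\<close> and the lower
  bound reads \<open>0 \<le> s'\<close> if \<open>q = \<infinity>\<close>.
\<close>

definition admissible :: "nat \<Rightarrow> ennreal \<Rightarrow> ennreal \<Rightarrow> real \<Rightarrow> real \<Rightarrow> bool" where
  "admissible d p q s s' \<longleftrightarrow>
    (if q = top then 0 \<le> s' else - real d * recip q < s') \<and>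
    s' \<le> s \<and>
    (if p = 1 then s \<le> 0 else s < real d * (1 - recip p))"

end

theory Submission
  imports Defs
begin

text \<open>
  Sufficiency. Scaling reduces the estimate to \<open>t = 1\<close> and to functions of norm at most 1. Write
  \<open>f = |y|^(-s) G\<close> with \<open>G\<close> in the unit ball of \<open>L^p\<close>; the operator to be bounded from \<open>L^p\<close> to \<open>L^q\<close> has, up to a
  constant, the kernel \<open>|x|^s' exp(-|x-y|\<^sup>2/4) |y|^(-s)\<close>. If \<open>x\<close> or \<open>y\<close> lies in the unit ball, then \<open>|x-y|\<^sup>2\<close>
  controls \<open>|x|\<^sup>2 + |y|\<^sup>2\<close>, and the kernel is at most a constant times the product of
  \<open>u(x) = |x|^s' exp(-|x|\<^sup>2/8)\<close> and \<open>w(y) = |y|^(-s) exp(-|y|\<^sup>2/8)\<close>. The lower bound on \<open>s'\<close> says that \<open>u\<close> is in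
  \<open>L^q\<close>, the upper bound on \<open>s\<close> says that \<open>w\<close> is in the dual of \<open>L^p\<close>, and so this part is bounded by duality
  (\<open>gauss_weight_duality\<close>). If both points are outside the unit ball, then \<open>s' \<le> s\<close> gives
  \<open>|x|^s' |y|^(-s) \<le> (|x|/|y|)^s \<le> (1 + |x-y|)^|s|\<close>, and the kernel is at most a function \<open>h(x-y)\<close> with \<open>h\<close> bounded
  and integrable; Young's inequality applies (\<open>convolution_bounded\<close>, \<open>convolution_powr_integral_le\<close>). The
  endpoint conventions of the condition are exactly those for which \<open>u\<close> and \<open>w\<close> are bounded when \<open>q = \<infinity>\<close> and
  \<open>p = 1\<close>. The two cases are combined in \<open>weighted_gauss_splitting\<close>.

  Necessity. Already the estimate at \<open>t = 1\<close> forces each of the three inequalities. The heat flow of the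
  indicator function of a ball is bounded below near the origin, so \<open>|x|^s'\<close> has to be in \<open>L^q\<close> there
  (\<open>lower_bound_necessary\<close>). Moving this ball to distance \<open>R\<close> from the origin and letting \<open>R\<close> tend to infinity
  gives \<open>s' \<le> s\<close> (\<open>weight_order_necessary\<close>). If the upper bound on \<open>s\<close> is violated, then
  \<open>|x|^(-d) / (1 - log |x|)\<close>, cut off to the unit ball, lies in \<open>L^p_s\<close> without being integrable, and its heat flow
  is not defined at any point (\<open>upper_bound_necessary\<close>).

  All integrals of powers of the norm are evaluated up to constants on the dyadic shells
  \<open>{x. r < |x| \<le> 2 r}\<close>, on which such a power is comparable to a constant.
\<close>

section \<open>Lebesgue measure under affine maps\<close>

lemma sigma_finite_lebesgue: "sigma_finite_measure (lebesgue :: 'a::euclidean_space measure)"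
proof -
  obtain A :: "'a set set" where A: "countable A" "A \<subseteq> sets lborel" "\<Union>A = space lborel"
      "\<forall>a\<in>A. emeasure lborel a \<noteq> \<infinity>"
    using lborel.sigma_finite_countable by blast
  then have "A \<subseteq> sets lebesgue" "\<forall>a\<in>A. emeasure lebesgue a \<noteq> \<infinity>"
    by (auto simp: subset_iff)
  with A show ?thesis
    by (intro sigma_finite_measure.intro exI[of _ A]) simp
qed

interpretation lebesgue: sigma_finite_measure "lebesgue :: 'a::euclidean_space measure"
  by (rule sigma_finite_lebesgue)

interpretation lebesgue_pair: pair_sigma_finite
    "lebesgue :: 'a::euclidean_space measure" "lebesgue :: 'b::euclidean_space measure"
  by unfold_locales

lemma
  fixes t :: "'a::euclidean_space"
  assumes "c \<noteq> 0"
  shows measurable_lebesgue_affine: "(\<lambda>x. t + c *\<^sub>R x) \<in> lebesgue \<rightarrow>\<^sub>M lebesgue"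
    and lebesgue_eq_density_affine:
      "lebesgue = density (distr lebesgue lebesgue (\<lambda>x. t + c *\<^sub>R x)) (\<lambda>_. ennreal (\<bar>c\<bar> ^ DIM('a)))"
proof -
  have T: "(\<lambda>x. t + (\<Sum>j\<in>Basis. (c * (x \<bullet> j)) *\<^sub>R j)) = (\<lambda>x. t + c *\<^sub>R x)"
    unfolding scaleR_scaleR[symmetric] scaleR_sum_right[symmetric] euclidean_representation ..
  show "(\<lambda>x. t + c *\<^sub>R x) \<in> lebesgue \<rightarrow>\<^sub>M lebesgue"
    using lebesgue_affine_measurable[of "\<lambda>_. c" t] assms by (simp add: T)
  show "lebesgue = density (distr lebesgue lebesgue (\<lambda>x. t + c *\<^sub>R x)) (\<lambda>_. ennreal (\<bar>c\<bar> ^ DIM('a)))"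
    using lebesgue_affine_euclidean[of "\<lambda>_. c" t] assms by (simp add: T)
qed

text \<open>
  The integrands below are only Lebesgue measurable, so the change of variables is needed for
  the completed measure and not just for \<^term>\<open>lborel\<close>.
\<close>

lemma nn_integral_lebesgue_affine:
  fixes t :: "'a::euclidean_space"
  assumes "c \<noteq> 0" and [measurable]: "u \<in> borel_measurable lebesgue"
  shows "(\<integral>\<^sup>+x. u x \<partial>lebesgue) = ennreal (\<bar>c\<bar> ^ DIM('a)) * (\<integral>\<^sup>+x. u (t + c *\<^sub>R x) \<partial>lebesgue)"
proof -
  note [measurable] = measurable_lebesgue_affine[OF assms(1), of t]
  show ?thesis
    by (subst lebesgue_eq_density_affine[OF assms(1), of t])
       (simp add: nn_integral_density nn_integral_distr nn_integral_cmult)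
qed

lemma integral_lebesgue_affine:
  fixes t :: "'a::euclidean_space" and u :: "'a \<Rightarrow> 'b::{banach, second_countable_topology}"
  assumes "c \<noteq> 0" and [measurable]: "u \<in> borel_measurable lebesgue"
  shows "(\<integral>x. u x \<partial>lebesgue) = \<bar>c\<bar> ^ DIM('a) *\<^sub>R (\<integral>x. u (t + c *\<^sub>R x) \<partial>lebesgue)"
proof -
  note [measurable] = measurable_lebesgue_affine[OF assms(1), of t]
  show ?thesis
    by (subst lebesgue_eq_density_affine[OF assms(1), of t])
       (simp add: integral_density integral_distr)
qed

lemma AE_lebesgue_neq: "AE x in lebesgue. x \<noteq> (a::'a::euclidean_space)"
  by (rule AE_I'[of "{a}"]) (auto simp: negligible_iff_null_sets[symmetric])

section \<open>Powers of the norm on dyadic shells\<close>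

text \<open>
  On a set where the norm varies by a factor of at most 4 a power weight is constant up to a
  factor. This replaces polar coordinates on dyadic shells, and it also compares a weight on a
  ball of radius 1 with its value at a distant centre.
\<close>

lemma powr_comparable:
  fixes r x a :: real
  assumes "0 < r" "r / 2 \<le> x" "x \<le> 2 * r"
  shows "x powr a \<le> 2 powr \<bar>a\<bar> * r powr a" "2 powr - \<bar>a\<bar> * r powr a \<le> x powr a"
proof -
  define y where "y = x / r"
  have y: "1/2 \<le> y" "y \<le> 2" "0 < y" and x: "x = y * r"
    using assms by (auto simp: y_def field_simps)
  have xa: "x powr a = y powr a * r powr a"
    using y assms by (simp add: x powr_mult)
  have ln: "\<bar>ln y\<bar> \<le> ln 2"
  proof -
    have "ln (1/2) \<le> ln y" "ln y \<le> ln 2" using y by (subst ln_le_cancel_iff; simp)+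
    then show ?thesis by (simp add: ln_div)
  qed
  have "\<bar>a * ln y\<bar> \<le> \<bar>a\<bar> * ln 2"
    using ln by (simp add: abs_mult mult_left_mono)
  then have "y powr a \<le> 2 powr \<bar>a\<bar>" "2 powr - \<bar>a\<bar> \<le> y powr a"
    using y by (auto simp: powr_def abs_le_iff)
  then show "x powr a \<le> 2 powr \<bar>a\<bar> * r powr a" "2 powr - \<bar>a\<bar> * r powr a \<le> x powr a"
    unfolding xa by (auto intro: mult_right_mono)
qed

definition shell :: "real \<Rightarrow> 'a::euclidean_space set" where
  "shell r = {x. r < norm x \<and> norm x \<le> 2 * r}"

lemma shell_sets [measurable]: "shell r \<in> sets borel"
  unfolding shell_def by measurable

definition shell_vol :: "nat \<Rightarrow> real" where
  "shell_vol d = unit_ball_vol (real d) * (2 ^ d - 1)"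

lemma shell_vol_pos: "0 < d \<Longrightarrow> 0 < shell_vol d"
  by (simp add: shell_vol_def)

lemma emeasure_shell:
  assumes "0 < r"
  shows "emeasure lborel (shell r :: 'a::euclidean_space set) = ennreal (shell_vol DIM('a) * r powr DIM('a))"
proof -
  have "shell r = cball 0 (2 * r) - (cball 0 r :: 'a set)"
    by (auto simp: shell_def)
  moreover have "cball 0 r \<subseteq> (cball 0 (2 * r) :: 'a set)"
    using assms by (intro subset_cball) simp
  ultimately have "emeasure lborel (shell r :: 'a set)
      = emeasure lborel (cball 0 (2 * r) :: 'a set) - emeasure lborel (cball 0 r :: 'a set)"
    using assms by (metis emeasure_Diff emeasure_cball ennreal_neq_top infinity_ennreal_def
        less_imp_le sets_lborel borel_closed closed_cball)
  also have "\<dots> = ennreal (shell_vol DIM('a) * r powr DIM('a))"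
    using assms
    by (simp add: emeasure_cball ennreal_minus powr_realpow shell_vol_def power_mult_distrib algebra_simps)
  finally show ?thesis .
qed

text \<open>
  The punctured unit ball is the disjoint union of the shells with radii \<open>2^-(k+1)\<close>; the index of
  the shell that contains a point is one less than the least \<open>n\<close> with \<open>2^-n < |x|\<close>.
\<close>

lemma nn_integral_inner_shells:
  fixes u :: "'a::euclidean_space \<Rightarrow> ennreal"
  assumes "u \<in> borel_measurable lborel"
  shows "(\<integral>\<^sup>+x. u x * indicator (cball 0 1 - {0}) x \<partial>lborel)
    = (\<Sum>k. \<integral>\<^sup>+x. u x * indicator (shell ((1/2) ^ Suc k)) x \<partial>lborel)"
proof -
  have "(\<Union>k. shell ((1/2) ^ Suc k)) = cball 0 1 - {0 :: 'a}"
  proof (intro equalityI subsetI)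
    fix x :: 'a assume "x \<in> (\<Union>k. shell ((1/2) ^ Suc k))"
    then obtain k where k: "(1/2) ^ Suc k < norm x" "norm x \<le> (1/2) ^ k"
      by (auto simp: shell_def)
    moreover have "(1/2 :: real) ^ k \<le> 1" by (rule power_le_one) auto
    ultimately show "x \<in> cball 0 1 - {0}"
      using zero_less_power[of "1/2 :: real" "Suc k"] by (auto simp del: zero_less_power)
  next
    fix x :: 'a assume x: "x \<in> cball 0 1 - {0}"
    then have "\<exists>n. (1/2) ^ n < norm x" by (intro real_arch_pow_inv) auto
    then have n: "(1/2) ^ (LEAST n. (1/2) ^ n < norm x) < norm x" by (rule LeastI_ex)
    moreover obtain k where k: "(LEAST n. (1/2) ^ n < norm x) = Suc k"
      using n x by (cases "LEAST n. (1/2) ^ n < norm x") auto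
    moreover have "\<not> (1/2) ^ k < norm x" by (rule not_less_Least) (simp add: k)
    ultimately have "x \<in> shell ((1/2) ^ Suc k)" by (auto simp: shell_def)
    then show "x \<in> (\<Union>k. shell ((1/2) ^ Suc k))" by blast
  qed
  moreover have "disjoint_family (\<lambda>k. shell ((1/2) ^ Suc k) :: 'a set)"
  proof -
    have "shell ((1/2) ^ Suc k) \<inter> shell ((1/2) ^ Suc l) = ({} :: 'a set)" if "k < l" for k l
    proof -
      have "(1/2 :: real) ^ l \<le> (1/2) ^ Suc k"
        using that by (intro power_decreasing) auto
      then show ?thesis by (auto simp: shell_def)
    qed
    then show ?thesis
      unfolding disjoint_family_on_def by (metis Int_commute linorder_neqE_nat)
  qed
  ultimately show ?thesis
    using nn_integral_disjoint_family[of u lborel "\<lambda>k. shell ((1/2) ^ Suc k)"] assms by simp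
qed

lemma nn_integral_outer_shells:
  fixes u :: "'a::euclidean_space \<Rightarrow> ennreal"
  assumes "u \<in> borel_measurable lborel"
  shows "(\<integral>\<^sup>+x. u x * indicator (- cball 0 1) x \<partial>lborel)
    = (\<Sum>k. \<integral>\<^sup>+x. u x * indicator (shell (2 ^ k)) x \<partial>lborel)"
proof -
  have "(\<Union>k. shell (2 ^ k)) = - cball 0 (1::real) \<inter> (UNIV :: 'a set)"
  proof (intro equalityI subsetI)
    fix x :: 'a assume "x \<in> (\<Union>k. shell (2 ^ k))"
    then obtain k where k: "2 ^ k < norm x" by (auto simp: shell_def)
    moreover have "1 \<le> (2 :: real) ^ k" by simp
    ultimately have "1 < norm x" by linarith
    then show "x \<in> - cball 0 1 \<inter> UNIV" by auto
  next
    fix x :: 'a assume x: "x \<in> - cball 0 1 \<inter> UNIV"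
    have "\<exists>n. norm x < 2 ^ n" by (rule real_arch_pow) auto
    then have "\<exists>n. norm x \<le> 2 ^ n" by (auto intro: less_imp_le)
    then have n: "norm x \<le> 2 ^ (LEAST n. norm x \<le> 2 ^ n)" by (rule LeastI_ex)
    moreover obtain k where k: "(LEAST n. norm x \<le> 2 ^ n) = Suc k"
      using n x by (cases "LEAST n. norm x \<le> 2 ^ n") auto
    moreover have "\<not> norm x \<le> 2 ^ k" by (rule not_less_Least) (simp add: k)
    ultimately have "x \<in> shell (2 ^ k)" by (auto simp: shell_def)
    then show "x \<in> (\<Union>k. shell (2 ^ k))" by blast
  qed
  moreover have "disjoint_family (\<lambda>k. shell (2 ^ k) :: 'a set)"
  proof -
    have "shell (2 ^ k) \<inter> shell (2 ^ l) = ({} :: 'a set)" if "k < l" for k l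
    proof -
      have "(2 :: real) ^ Suc k \<le> 2 ^ l"
        using that by (intro power_increasing) auto
      then show ?thesis by (auto simp: shell_def)
    qed
    then show ?thesis
      unfolding disjoint_family_on_def by (metis Int_commute linorder_neqE_nat)
  qed
  ultimately show ?thesis
    using nn_integral_disjoint_family[of u lborel "\<lambda>k. shell (2 ^ k)"] assms by simp
qed

lemma nn_integral_shell_le:
  fixes u :: "'a::euclidean_space \<Rightarrow> ennreal"
  assumes "0 < r" "0 \<le> b" "\<And>x. x \<in> shell r \<Longrightarrow> u x \<le> ennreal b"
  shows "(\<integral>\<^sup>+x. u x * indicator (shell r) x \<partial>lborel) \<le> ennreal (b * (shell_vol DIM('a) * r powr DIM('a)))"
proof -
  have "(\<integral>\<^sup>+x. u x * indicator (shell r) x \<partial>lborel) \<le> (\<integral>\<^sup>+x. ennreal b * indicator (shell r :: 'a set) x \<partial>lborel)"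
    using assms(3) by (intro nn_integral_mono) (auto split: split_indicator)
  also have "\<dots> = ennreal (b * (shell_vol DIM('a) * r powr DIM('a)))"
    using assms by (simp add: nn_integral_cmult_indicator emeasure_shell ennreal_mult')
  finally show ?thesis .
qed

lemma nn_integral_shell_ge:
  fixes u :: "'a::euclidean_space \<Rightarrow> ennreal"
  assumes "0 < r" "0 \<le> b" "\<And>x. x \<in> shell r \<Longrightarrow> ennreal b \<le> u x"
  shows "ennreal (b * (shell_vol DIM('a) * r powr DIM('a))) \<le> (\<integral>\<^sup>+x. u x * indicator (shell r) x \<partial>lborel)"
proof -
  have "ennreal (b * (shell_vol DIM('a) * r powr DIM('a))) = (\<integral>\<^sup>+x. ennreal b * indicator (shell r :: 'a set) x \<partial>lborel)"
    using assms by (simp add: nn_integral_cmult_indicator emeasure_shell ennreal_mult')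
  also have "\<dots> \<le> (\<integral>\<^sup>+x. u x * indicator (shell r) x \<partial>lborel)"
    using assms(3) by (intro nn_integral_mono) (auto split: split_indicator)
  finally show ?thesis .
qed

lemma suminf_le_ennreal_finite:
  fixes f :: "nat \<Rightarrow> ennreal"
  assumes "\<And>k. f k \<le> ennreal (g k)" "\<And>k. 0 \<le> g k" "summable g"
  shows "(\<Sum>k. f k) < top"
proof -
  have "(\<Sum>k. f k) \<le> (\<Sum>k. ennreal (g k))"
    using assms(1) by (intro suminf_le) auto
  also have "\<dots> = ennreal (suminf g)" by (rule suminf_ennreal2[OF assms(2,3)])
  finally show ?thesis by (auto simp: less_top[symmetric] top_unique)
qed

lemma suminf_ge_ennreal_infinite:
  fixes f :: "nat \<Rightarrow> ennreal"
  assumes "\<And>k. ennreal (g k) \<le> f k" "\<And>k. 0 \<le> g k" "\<not> summable g"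
  shows "(\<Sum>k. f k) = top"
proof (rule ccontr)
  assume "(\<Sum>k. f k) \<noteq> top"
  moreover have "(\<Sum>k. ennreal (g k)) \<le> (\<Sum>k. f k)"
    using assms(1) by (intro suminf_le) auto
  ultimately have "(\<Sum>k. ennreal (g k)) \<noteq> top" by (auto simp: top_unique)
  then show False using assms(2,3) summable_suminf_not_top by blast
qed

lemma powr_power_commute: "0 < (c::real) \<Longrightarrow> (c ^ k) powr a = (c powr a) ^ k"
  by (simp add: powr_powr powr_realpow[symmetric] mult.commute)

text \<open>
  The shell of radius \<open>r\<close> contributes about \<open>r^(a+d)\<close>, so the sum over the shells is a convergent
  geometric series.
\<close>

lemma power_integrable_at_0:
  fixes a :: real
  assumes "- real DIM('a) < a"
  shows "(\<integral>\<^sup>+x. ennreal (norm x powr a) * indicator (cball 0 1 - {0}) x \<partial>(lborel :: 'a::euclidean_space measure)) < top"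
proof -
  let ?d = "real DIM('a)" and ?\<rho> = "(1/2) powr (a + real DIM('a))"
  let ?c = "2 powr \<bar>a\<bar> * shell_vol DIM('a)"
  have c: "0 \<le> ?c" using shell_vol_pos[of "DIM('a)"] by auto
  have \<rho>: "?\<rho> < 1" using assms powr_less_mono2[of "a + ?d" "1/2" 1] by simp
  have "summable (\<lambda>k. ?c * ?\<rho> ^ Suc k)"
    using \<rho> by (intro summable_mult summable_Suc_iff[THEN iffD2] summable_geometric) auto
  moreover have "(\<integral>\<^sup>+x. ennreal (norm x powr a) * indicator (shell ((1/2) ^ Suc k)) x \<partial>(lborel :: 'a measure))
      \<le> ennreal (?c * ?\<rho> ^ Suc k)" for k
  proof -
    let ?r = "(1/2) ^ Suc k :: real"
    have "(\<integral>\<^sup>+x. ennreal (norm x powr a) * indicator (shell ?r) x \<partial>(lborel :: 'a measure))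
      \<le> ennreal ((2 powr \<bar>a\<bar> * ?r powr a) * (shell_vol DIM('a) * ?r powr ?d))"
      by (intro nn_integral_shell_le ennreal_leI powr_comparable) (auto simp: shell_def)
    also have "(2 powr \<bar>a\<bar> * ?r powr a) * (shell_vol DIM('a) * ?r powr ?d) = ?c * ?r powr (a + ?d)"
      by (simp add: powr_add mult_ac)
    also have "?r powr (a + ?d) = ?\<rho> ^ Suc k" by (rule powr_power_commute) simp
    finally show ?thesis .
  qed
  ultimately show ?thesis
    using c by (subst nn_integral_inner_shells) (auto intro!: suminf_le_ennreal_finite)
qed

lemma power_integrable_at_infinity:
  fixes a :: real
  assumes "a < - real DIM('a)"
  shows "(\<integral>\<^sup>+x. ennreal (norm x powr a) * indicator (- cball 0 1) x \<partial>(lborel :: 'a::euclidean_space measure)) < top"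
proof -
  let ?d = "real DIM('a)" and ?\<rho> = "2 powr (a + real DIM('a))"
  let ?c = "2 powr \<bar>a\<bar> * shell_vol DIM('a)"
  have c: "0 \<le> ?c" using shell_vol_pos[of "DIM('a)"] by auto
  have \<rho>: "?\<rho> < 1" using assms powr_less_mono[of "a + ?d" 0 2] by simp
  have "summable (\<lambda>k. ?c * ?\<rho> ^ k)"
    using \<rho> by (intro summable_mult summable_geometric) auto
  moreover have "(\<integral>\<^sup>+x. ennreal (norm x powr a) * indicator (shell (2 ^ k)) x \<partial>(lborel :: 'a measure))
      \<le> ennreal (?c * ?\<rho> ^ k)" for k
  proof -
    let ?r = "2 ^ k :: real"
    have "r / 2 \<le> x" if "r < x" "0 < r" for r x :: real using that by simp
    then have "(\<integral>\<^sup>+x. ennreal (norm x powr a) * indicator (shell ?r) x \<partial>(lborel :: 'a measure))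
      \<le> ennreal ((2 powr \<bar>a\<bar> * ?r powr a) * (shell_vol DIM('a) * ?r powr ?d))"
      by (intro nn_integral_shell_le ennreal_leI powr_comparable) (auto simp: shell_def)
    also have "(2 powr \<bar>a\<bar> * ?r powr a) * (shell_vol DIM('a) * ?r powr ?d) = ?c * ?r powr (a + ?d)"
      by (simp add: powr_add mult_ac)
    also have "?r powr (a + ?d) = ?\<rho> ^ k" by (rule powr_power_commute) simp
    finally show ?thesis .
  qed
  ultimately show ?thesis
    using c by (subst nn_integral_outer_shells) (auto intro!: suminf_le_ennreal_finite)
qed

text \<open>
  Here each shell contributes at least a fixed amount.
\<close>

lemma power_not_integrable_at_0:
  fixes a :: real
  assumes "a \<le> - real DIM('a)"
  shows "(\<integral>\<^sup>+x. ennreal (norm x powr a) * indicator (cball 0 1 - {0}) x \<partial>(lborel :: 'a::euclidean_space measure)) = top"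
proof -
  let ?d = "real DIM('a)"
  let ?c = "2 powr - \<bar>a\<bar> * shell_vol DIM('a)"
  have c: "0 < ?c" using shell_vol_pos[of "DIM('a)"] by auto
  have "\<not> summable (\<lambda>k::nat. ?c)" using c summable_const_iff[of ?c] by auto
  moreover have "ennreal ?c \<le> (\<integral>\<^sup>+x. ennreal (norm x powr a) * indicator (shell ((1/2) ^ Suc k)) x \<partial>(lborel :: 'a measure))" for k
  proof -
    let ?r = "(1/2) ^ Suc k :: real"
    have r: "0 < ?r" "?r \<le> 1" using power_le_one[of "1/2::real" "Suc k"] by auto
    have "1 \<le> ?r powr (a + ?d)" using assms r powr_mono'[of "a + ?d" 0 ?r] by simp
    then have "?c \<le> ?c * ?r powr (a + ?d)" using c mult_left_mono[of 1 "?r powr (a + ?d)" ?c] by simp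
    also have "\<dots> = (2 powr - \<bar>a\<bar> * ?r powr a) * (shell_vol DIM('a) * ?r powr ?d)"
      by (simp add: powr_add mult_ac)
    finally have "ennreal ?c \<le> ennreal \<dots>" by (rule ennreal_leI)
    also have "\<dots> \<le> (\<integral>\<^sup>+x. ennreal (norm x powr a) * indicator (shell ?r) x \<partial>(lborel :: 'a measure))"
      by (intro nn_integral_shell_ge ennreal_leI powr_comparable) (auto simp: shell_def)
    finally show ?thesis .
  qed
  moreover have "0 \<le> ?c" using c by simp
  ultimately show ?thesis
    by (subst nn_integral_inner_shells, simp)
       (rule suminf_ge_ennreal_infinite[of "\<lambda>_. ?c"]; assumption)
qed

section \<open>Gaussian weights and the splitting of the heat kernel\<close>

lemma lebesgue_borel_ident_measurable: "(\<lambda>x. x) \<in> borel_measurable lebesgue"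
  by (rule measurable_completion) simp

lemma cball_borel [measurable]: "cball a r \<in> sets (borel :: 'a::metric_space measure)"
  by (rule borel_closed) simp

lemma
  assumes [measurable]: "u \<in> borel_measurable M" "v \<in> borel_measurable M"
  shows nn_integral_add_cmult: "(\<integral>\<^sup>+x. u x + c * v x \<partial>M) = (\<integral>\<^sup>+x. u x \<partial>M) + c * (\<integral>\<^sup>+x. v x \<partial>M)"
    and nn_integral_cmult_add: "(\<integral>\<^sup>+x. c * (u x + v x) \<partial>M) = c * ((\<integral>\<^sup>+x. u x \<partial>M) + (\<integral>\<^sup>+x. v x \<partial>M))"
  by (simp_all add: nn_integral_add nn_integral_cmult)

text \<open>
  From \<open>(z/n)^n \<le> exp z\<close> with \<open>z = b r\<^sup>2\<close>, where \<open>n\<close> is chosen so that \<open>r powr m \<le> r^(2n)\<close>.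
\<close>

lemma powr_gauss_bounded_ge_1:
  fixes m b :: real
  assumes "0 < b"
  obtains C where "0 < C" "\<And>r. 1 \<le> r \<Longrightarrow> r powr m * exp (- b * r\<^sup>2) \<le> C"
proof -
  \<comment> \<open>The successor only makes sure that the exponent is positive.\<close>
  obtain n0 :: nat where n0: "m \<le> real n0" using real_arch_simple by blast
  define n where "n = Suc n0"
  have n: "m \<le> 2 * real n" "0 < n" using n0 by (auto simp: n_def)
  show ?thesis
  proof
    show "0 < (real n / b) ^ n" using n assms by simp
    fix r :: real assume r: "1 \<le> r"
    have "(b * r\<^sup>2 / real n) ^ n \<le> (1 + b * r\<^sup>2 / real n) ^ n"
      using assms by (intro power_mono) auto
    also have "\<dots> \<le> exp (b * r\<^sup>2)"
    proof (rule exp_ge_one_plus_x_over_n_power_n)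
      have "0 \<le> b * r\<^sup>2" using assms by simp
      then show "- real n \<le> b * r\<^sup>2" by linarith
    qed (use n in simp)
    finally have e: "(b * r\<^sup>2 / real n) ^ n \<le> exp (b * r\<^sup>2)" .
    have "r powr m \<le> r powr (2 * real n)" using r n by (intro powr_mono) auto
    also have "\<dots> = (r\<^sup>2) ^ n" using r powr_realpow[of r "2 * n"] by (simp add: power_mult)
    also have "\<dots> = (real n / b) ^ n * (b * r\<^sup>2 / real n) ^ n"
      using n assms by (simp add: power_mult_distrib[symmetric])
    also have "\<dots> \<le> (real n / b) ^ n * exp (b * r\<^sup>2)"
      using e assms by (intro mult_left_mono) auto
    finally have "r powr m * exp (- b * r\<^sup>2) \<le> (real n / b) ^ n * exp (b * r\<^sup>2) * exp (- b * r\<^sup>2)"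
      by (intro mult_right_mono) auto
    also have "\<dots> = (real n / b) ^ n" by (simp add: exp_add[symmetric])
    finally show "r powr m * exp (- b * r\<^sup>2) \<le> (real n / b) ^ n" .
  qed
qed

lemma powr_gauss_bounded:
  fixes m b :: real
  assumes "0 < b" "0 \<le> m"
  obtains C where "0 < C" "\<And>r. 0 \<le> r \<Longrightarrow> r powr m * exp (- b * r\<^sup>2) \<le> C"
proof -
  obtain C where C: "0 < C" "\<And>r. 1 \<le> r \<Longrightarrow> r powr m * exp (- b * r\<^sup>2) \<le> C"
    using powr_gauss_bounded_ge_1[OF assms(1)] by blast
  have "r powr m * exp (- b * r\<^sup>2) \<le> C + 1" if r: "0 \<le> r" for r
  proof (cases "1 \<le> r")
    case True with C(2)[of r] show ?thesis by simp
  next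
    case False
    then have "r powr m \<le> 1" using r assms by (intro powr_le1) auto
    moreover have "exp (- b * r\<^sup>2) \<le> 1" using assms by simp
    ultimately have "r powr m * exp (- b * r\<^sup>2) \<le> 1 * 1" by (intro mult_mono) auto
    with C show ?thesis by simp
  qed
  with C(1) show ?thesis using that[of "C + 1"] by simp
qed

text \<open>
  Outside the unit ball the Gaussian absorbs any power of the norm, in particular one that leaves
  \<open>|x|^(-d-1)\<close>.
\<close>

lemma powr_gauss_integrable:
  fixes a b :: real
  assumes "- real DIM('a) < a" "0 < b"
  shows "(\<integral>\<^sup>+x. ennreal (norm x powr a * exp (- b * (norm x)\<^sup>2)) \<partial>(lebesgue :: 'a::euclidean_space measure)) < top"
proof -
  let ?e = "- real DIM('a) - 1"
  obtain C where C: "0 < C" "\<And>r. 1 \<le> r \<Longrightarrow> r powr (a - ?e) * exp (- b * r\<^sup>2) \<le> C"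
    using powr_gauss_bounded_ge_1[OF assms(2)] by blast
  have "(\<integral>\<^sup>+x. ennreal (norm x powr a * exp (- b * (norm x)\<^sup>2)) \<partial>(lebesgue :: 'a measure))
     = (\<integral>\<^sup>+x. ennreal (norm x powr a * exp (- b * (norm x)\<^sup>2)) \<partial>(lborel :: 'a measure))"
    by (rule nn_integral_completion)
  also have "\<dots> \<le> (\<integral>\<^sup>+x. ennreal (norm x powr a) * indicator (cball 0 1 - {0}) x
      + ennreal C * (ennreal (norm x powr ?e) * indicator (- cball 0 1) x) \<partial>(lborel :: 'a measure))"
  proof (rule nn_integral_mono)
    fix x :: 'a
    consider "x = 0" | "x \<noteq> 0" "norm x \<le> 1" | "1 < norm x" by linarith
    then show "ennreal (norm x powr a * exp (- b * (norm x)\<^sup>2))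
      \<le> ennreal (norm x powr a) * indicator (cball 0 1 - {0}) x
      + ennreal C * (ennreal (norm x powr ?e) * indicator (- cball 0 1) x)"
    proof cases
      case 2
      have "norm x powr a * exp (- b * (norm x)\<^sup>2) \<le> norm x powr a * 1"
        using assms by (intro mult_left_mono) auto
      with 2 show ?thesis by (simp add: ennreal_leI)
    next
      case 3
      have "norm x powr a = norm x powr (a - ?e) * norm x powr ?e" by (simp add: powr_add[symmetric])
      then have "norm x powr a * exp (- b * (norm x)\<^sup>2)
          = (norm x powr (a - ?e) * exp (- b * (norm x)\<^sup>2)) * norm x powr ?e" by simp
      also have "\<dots> \<le> C * norm x powr ?e" using C(2)[of "norm x"] 3 by (intro mult_right_mono) auto
      finally have "ennreal (norm x powr a * exp (- b * (norm x)\<^sup>2)) \<le> ennreal C * ennreal (norm x powr ?e)"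
        using C by (simp add: ennreal_leI ennreal_mult'[symmetric])
      with 3 show ?thesis by simp
    qed simp
  qed
  also have "\<dots> = (\<integral>\<^sup>+x. ennreal (norm x powr a) * indicator (cball 0 1 - {0}) x \<partial>(lborel :: 'a measure))
      + ennreal C * (\<integral>\<^sup>+x. ennreal (norm x powr ?e) * indicator (- cball 0 1) x \<partial>(lborel :: 'a measure))"
    by (rule nn_integral_add_cmult; measurable)
  also have "\<dots> < top"
    using power_integrable_at_0[OF assms(1)] power_integrable_at_infinity[of ?e, where 'a='a]
    by (simp add: ennreal_mult_less_top)
  finally show ?thesis .
qed

text \<open>
  For \<open>a = |x|\<close>, \<open>b = |y|\<close>, \<open>c = |x - y|\<close>: if one of the two points is in the unit ball, then the
  distance controls both norms, \<open>a\<^sup>2 + b\<^sup>2 \<le> 3 + 2 c\<^sup>2\<close>, and the Gaussian factorises at the cost of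
  a worse exponent.
\<close>

lemma gauss_le_product_of_gauss:
  fixes a b c :: real
  assumes "0 \<le> a" "0 \<le> b" "0 \<le> c" "a \<le> b + c" "b \<le> a + c" "a \<le> 1 \<or> b \<le> 1"
  shows "exp (- c\<^sup>2 / 4) \<le> exp (3/8) * exp (- a\<^sup>2 / 8) * exp (- b\<^sup>2 / 8)"
proof -
  have *: "v\<^sup>2 \<le> 1" "u\<^sup>2 \<le> 2 * v\<^sup>2 + 2 * c\<^sup>2" if "0 \<le> v" "v \<le> 1" "0 \<le> u" "u \<le> v + c" for u v
  proof -
    show "v\<^sup>2 \<le> 1" using that by (simp add: power_le_one)
    have "u\<^sup>2 \<le> (v + c)\<^sup>2" using that by (intro power_mono) auto
    also have "\<dots> \<le> 2 * v\<^sup>2 + 2 * c\<^sup>2" using sum_squares_bound[of v c] by (simp add: power2_sum)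
    finally show "u\<^sup>2 \<le> 2 * v\<^sup>2 + 2 * c\<^sup>2" .
  qed
  have "a\<^sup>2 + b\<^sup>2 \<le> 3 + 2 * c\<^sup>2"
    using assms(6)
  proof
    assume "a \<le> 1" with *[of a b] assms show ?thesis by simp
  next
    assume "b \<le> 1" with *[of b a] assms show ?thesis by simp
  qed
  then show ?thesis by (simp add: exp_add[symmetric])
qed

lemma one_plus_powr_le:
  fixes c \<sigma> :: real
  assumes "0 \<le> c" "0 \<le> \<sigma>"
  shows "(1 + c) powr \<sigma> \<le> 2 powr \<sigma> * (1 + c powr \<sigma>)"
proof -
  have "(1 + c) powr \<sigma> \<le> (2 * max 1 c) powr \<sigma>" using assms by (intro powr_mono2) auto
  also have "\<dots> = 2 powr \<sigma> * max 1 c powr \<sigma>" using assms by (simp add: powr_mult)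
  also have "\<dots> \<le> 2 powr \<sigma> * (1 + c powr \<sigma>)" by (intro mult_left_mono) (auto simp: max_def)
  finally show ?thesis .
qed

text \<open>
  This is the only place where \<open>s' \<le> s\<close> enters the upper bound: for \<open>a \<ge> 1\<close> it allows \<open>s'\<close> to be replaced
  by \<open>s\<close>, and the remaining quotient \<open>(a/b) powr s\<close> depends only on the distance, since both
  \<open>a/b\<close> and \<open>b/a\<close> are at most \<open>1 + c\<close>.
\<close>

lemma quotient_of_weights_le:
  fixes a b c s s' :: real
  assumes "1 \<le> a" "1 \<le> b" "0 \<le> c" "a \<le> b + c" "b \<le> a + c" "s' \<le> s"
  shows "a powr s' * b powr - s \<le> 2 powr \<bar>s\<bar> * (1 + c powr \<bar>s\<bar>)"
proof -
  have q: "u / v \<le> 1 + c" if "1 \<le> v" "u \<le> v + c" for u v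
  proof -
    have "c * 1 \<le> c * v" using that assms by (intro mult_left_mono) auto
    with that have "u \<le> (1 + c) * v" by (simp add: algebra_simps)
    with that show ?thesis by (simp add: divide_le_eq)
  qed
  have "a powr s' * b powr - s \<le> a powr s * b powr - s"
    using assms by (intro mult_right_mono powr_mono) auto
  also have "\<dots> \<le> (1 + c) powr \<bar>s\<bar>"
  proof (cases "0 \<le> s")
    case True
    have "a powr s * b powr - s = (a / b) powr s"
      using assms by (simp add: powr_divide powr_minus_divide)
    also have "\<dots> \<le> (1 + c) powr s" using q[of b a] assms True by (intro powr_mono2) auto
    finally show ?thesis using True by simp
  next
    case False
    have "a powr s * b powr - s = (b / a) powr - s"
      using assms by (simp add: powr_divide powr_minus_divide)
    also have "\<dots> \<le> (1 + c) powr - s" using q[of a b] assms False by (intro powr_mono2) auto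
    finally show ?thesis using False by simp
  qed
  also have "\<dots> \<le> 2 powr \<bar>s\<bar> * (1 + c powr \<bar>s\<bar>)"
    using assms by (intro one_plus_powr_le) auto
  finally show ?thesis .
qed

text \<open>
  The two ingredients of the kernel splitting: a power weight with Gaussian decay, and a
  Gaussian with a polynomial factor that serves as convolution kernel.
\<close>

definition gauss_weight :: "real \<Rightarrow> 'a::euclidean_space \<Rightarrow> real" where
  "gauss_weight a x = norm x powr a * exp (- (norm x)\<^sup>2 / 8)"

definition moment_kernel :: "real \<Rightarrow> 'a::euclidean_space \<Rightarrow> real" where
  "moment_kernel \<sigma> z = 2 powr \<sigma> * (1 + norm z powr \<sigma>) * exp (- (norm z)\<^sup>2 / 4)"

lemma gauss_weight_nonneg [simp]: "0 \<le> gauss_weight a x"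
  by (simp add: gauss_weight_def)

lemma moment_kernel_nonneg [simp]: "0 \<le> moment_kernel \<sigma> x"
  by (simp add: moment_kernel_def)

lemma gauss_weight_measurable [measurable]: "gauss_weight a \<in> borel_measurable borel"
  unfolding gauss_weight_def by measurable

lemma moment_kernel_measurable [measurable]: "moment_kernel a \<in> borel_measurable borel"
  unfolding moment_kernel_def by measurable

text \<open>
  The weighted heat kernel is at most a rank-one kernel plus a convolution kernel. If one of the
  points lies in the unit ball the Gaussian factorises and the singular weights separate;
  otherwise both weights are harmless and only their quotient matters.
\<close>

lemma weighted_gauss_splitting:
  fixes x y :: "'a::euclidean_space"
  assumes "s' \<le> s"
  shows "norm x powr s' * exp (- (norm (x - y))\<^sup>2 / 4) * norm y powr - s
    \<le> exp (3/8) * gauss_weight s' x * gauss_weight (- s) y + moment_kernel \<bar>s\<bar> (x - y)"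
proof -
  let ?a = "norm x" and ?b = "norm y" and ?c = "norm (x - y)"
  have tri: "?a \<le> ?b + ?c" "?b \<le> ?a + ?c"
    using norm_triangle_ineq[of y "x - y"] norm_triangle_ineq[of x "y - x"] by (auto simp: norm_minus_commute)
  show ?thesis
  proof (cases "?a \<le> 1 \<or> ?b \<le> 1")
    case True
    have "?a powr s' * exp (- ?c\<^sup>2 / 4) * ?b powr - s
       \<le> ?a powr s' * (exp (3/8) * exp (- ?a\<^sup>2 / 8) * exp (- ?b\<^sup>2 / 8)) * ?b powr - s"
      using tri True by (intro mult_left_mono mult_right_mono gauss_le_product_of_gauss) auto
    also have "\<dots> = exp (3/8) * gauss_weight s' x * gauss_weight (- s) y"
      by (simp add: gauss_weight_def mult_ac)
    finally show ?thesis using moment_kernel_nonneg[of "\<bar>s\<bar>" "x - y"] by linarith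
  next
    case False
    then have "(?a powr s' * ?b powr - s) * exp (- ?c\<^sup>2 / 4) \<le> moment_kernel \<bar>s\<bar> (x - y)"
      unfolding moment_kernel_def using tri assms by (intro mult_right_mono quotient_of_weights_le) auto
    moreover have "0 \<le> exp (3/8) * gauss_weight s' x * gauss_weight (- s) y" by simp
    moreover have "?a powr s' * exp (- ?c\<^sup>2 / 4) * ?b powr - s = (?a powr s' * ?b powr - s) * exp (- ?c\<^sup>2 / 4)"
      by simp
    ultimately show ?thesis by linarith
  qed
qed

text \<open>
  With \<open>a = s'\<close> and \<open>r = q\<close> this is where the lower bound \<open>-d/q < s'\<close> is used; with \<open>a = -s\<close> and
  \<open>r\<close> the conjugate exponent of \<open>p\<close> it is where \<open>s < d (1 - 1/p)\<close> is used.
\<close>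

lemma gauss_weight_powr_integrable:
  assumes "- real DIM('a) < a * r" "0 < r"
  shows "(\<integral>\<^sup>+x. ennreal (gauss_weight a x powr r) \<partial>(lebesgue :: 'a::euclidean_space measure)) < top"
proof -
  have "gauss_weight a x powr r = norm x powr (a * r) * exp (- (r / 8) * (norm x)\<^sup>2)" for x :: 'a
    using assms by (simp add: gauss_weight_def powr_mult powr_powr exp_powr_real mult_ac)
  then show ?thesis using powr_gauss_integrable[OF assms(1), of "r / 8"] assms by simp
qed

lemma gauss_weight_bounded:
  assumes "0 \<le> a"
  obtains C where "0 < C" "\<And>x::'a::euclidean_space. gauss_weight a x \<le> C"
proof -
  obtain C where "0 < C" "\<And>r. 0 \<le> r \<Longrightarrow> r powr a * exp (- (1/8) * r\<^sup>2) \<le> C"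
    using powr_gauss_bounded[of "1/8" a] assms by auto
  then show ?thesis using that[of C] by (simp add: gauss_weight_def)
qed

lemma moment_kernel_bounded:
  assumes "0 \<le> \<sigma>"
  obtains H where "1 \<le> H" "\<And>z::'a::euclidean_space. moment_kernel \<sigma> z \<le> H"
    "(\<integral>\<^sup>+z. ennreal (moment_kernel \<sigma> (z::'a)) \<partial>lebesgue) \<le> ennreal H"
proof -
  obtain C where C: "0 < C" "\<And>r. 0 \<le> r \<Longrightarrow> r powr \<sigma> * exp (- (1/4) * r\<^sup>2) \<le> C"
    using powr_gauss_bounded[of "1/4" \<sigma>] assms by auto
  have bd: "moment_kernel \<sigma> z \<le> 2 powr \<sigma> * (1 + C)" for z :: 'a
  proof -
    have "exp (- (norm z)\<^sup>2 / 4) + norm z powr \<sigma> * exp (- (norm z)\<^sup>2 / 4) \<le> 1 + C"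
      using C(2)[of "norm z"] by (intro add_mono) auto
    then have "2 powr \<sigma> * ((1 + norm z powr \<sigma>) * exp (- (norm z)\<^sup>2 / 4)) \<le> 2 powr \<sigma> * (1 + C)"
      by (intro mult_left_mono) (auto simp: algebra_simps)
    then show ?thesis by (simp add: moment_kernel_def mult_ac)
  qed
  note [measurable] = lebesgue_borel_ident_measurable
  have d: "- real DIM('a) < 0" by simp
  then have "- real DIM('a) < \<sigma>" using assms by linarith
  note d = d this
  let ?J = "\<lambda>m. (\<integral>\<^sup>+z. ennreal (norm (z::'a) powr m * exp (- (1/4) * (norm z)\<^sup>2)) \<partial>lebesgue)"
  have "(\<integral>\<^sup>+z. ennreal (moment_kernel \<sigma> (z::'a)) \<partial>lebesgue)
     = (\<integral>\<^sup>+z. ennreal (2 powr \<sigma>) * (ennreal (norm (z::'a) powr 0 * exp (- (1/4) * (norm z)\<^sup>2))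
         + ennreal (norm z powr \<sigma> * exp (- (1/4) * (norm z)\<^sup>2))) \<partial>lebesgue)"
  proof (rule nn_integral_cong_AE)
    show "AE z::'a in lebesgue. ennreal (moment_kernel \<sigma> z)
      = ennreal (2 powr \<sigma>) * (ennreal (norm z powr 0 * exp (- (1/4) * (norm z)\<^sup>2))
         + ennreal (norm z powr \<sigma> * exp (- (1/4) * (norm z)\<^sup>2)))"
      using AE_lebesgue_neq[of 0]
    proof eventually_elim
      case (elim z)
      then show ?case
        by (simp add: moment_kernel_def ennreal_plus[symmetric] ennreal_mult'[symmetric] algebra_simps
            del: ennreal_plus)
    qed
  qed
  also have "\<dots> = ennreal (2 powr \<sigma>) * (?J 0 + ?J \<sigma>)"
    by (rule nn_integral_cmult_add; measurable)
  also have "\<dots> < top"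
    using powr_gauss_integrable[of 0 "1/4", where 'a='a] powr_gauss_integrable[of \<sigma> "1/4", where 'a='a] d
    by (simp add: ennreal_mult_less_top)
  finally obtain J where J: "0 \<le> J" "(\<integral>\<^sup>+z. ennreal (moment_kernel \<sigma> (z::'a)) \<partial>lebesgue) = ennreal J"
    using less_top_ennreal by blast
  show ?thesis
  proof
    show "1 \<le> max 1 (max J (2 powr \<sigma> * (1 + C)))" by simp
    show "moment_kernel \<sigma> z \<le> max 1 (max J (2 powr \<sigma> * (1 + C)))" for z :: 'a
      using bd[of z] by simp
    show "(\<integral>\<^sup>+z. ennreal (moment_kernel \<sigma> (z::'a)) \<partial>lebesgue) \<le> ennreal (max 1 (max J (2 powr \<sigma> * (1 + C))))"
      unfolding J by (rule ennreal_leI) simp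
  qed
qed

section \<open>Norms and their behaviour under dilation\<close>

lemma exponent_cases:
  assumes "1 \<le> (q::ennreal)"
  obtains (infinite) "q = top" "recip q = 0"
  | (finite) r where "1 \<le> r" "q = ennreal r" "q \<noteq> top" "enn2real q = r" "recip q = 1 / r"
proof (cases q)
  case (real r)
  with assms have r: "1 \<le> r" by (simp flip: ennreal_1)
  moreover have "1 / ennreal r = ennreal (1 / r)"
    using r divide_ennreal[of 1 r] by simp
  ultimately show ?thesis using real finite[of r] by (simp add: recip_def)
next
  case top
  then show ?thesis using infinite by (simp add: recip_def)
qed

text \<open>
  Upper bounds for norms are all that the positive part requires, so this equivalence and the
  next one take the place of computations with the norm itself.
\<close>

lemma Lq_norm_finite_le_iff:
  assumes "1 \<le> r" "0 \<le> C"
  shows "Lq_norm (ennreal r) h \<le> ennreal C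
    \<longleftrightarrow> (\<integral>\<^sup>+x. ennreal (norm (h x) powr r) \<partial>lebesgue) \<le> ennreal (C powr r)"
proof -
  have r: "enn2real (ennreal r) = r" "recip (ennreal r) = 1 / r"
    using assms(1) divide_ennreal[of 1 r] by (auto simp: recip_def)
  show ?thesis
  proof (cases "\<integral>\<^sup>+x. ennreal (norm (h x) powr r) \<partial>lebesgue")
    case (real i)
    have "i powr (1 / r) \<le> C \<longleftrightarrow> i \<le> C powr r"
    proof
      assume "i powr (1 / r) \<le> C"
      then have "(i powr (1 / r)) powr r \<le> C powr r" using assms by (intro powr_mono2) auto
      then show "i \<le> C powr r" using assms real by (simp add: powr_powr)
    next
      assume "i \<le> C powr r"
      then have "i powr (1 / r) \<le> (C powr r) powr (1 / r)" using assms real by (intro powr_mono2) auto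
      then show "i powr (1 / r) \<le> C" using assms by (simp add: powr_powr)
    qed
    with real show ?thesis using assms by (simp add: Lq_norm_def r Let_def)
  next
    case top
    then show ?thesis by (simp add: Lq_norm_def r top_unique)
  qed
qed

lemma Lq_norm_top_le_iff:
  assumes [measurable]: "h \<in> borel_measurable lebesgue" and "0 \<le> C"
  shows "Lq_norm top h \<le> ennreal C \<longleftrightarrow> (AE x in lebesgue. norm (h x) \<le> C)"
proof
  assume le: "Lq_norm top h \<le> ennreal C"
  have "AE x in lebesgue. ennreal (norm (h x)) \<le> Lq_norm top h"
    unfolding Lq_norm_def by (simp add: esssup_AE)
  then show "AE x in lebesgue. norm (h x) \<le> C"
  proof eventually_elim
    case (elim x)
    from elim le have "ennreal (norm (h x)) \<le> ennreal C" by (rule order_trans)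
    with assms(2) show ?case by simp
  qed
next
  assume "AE x in lebesgue. norm (h x) \<le> C"
  then show "Lq_norm top h \<le> ennreal C"
    using assms(2) by (auto simp: Lq_norm_def intro!: esssup_I)
qed

text \<open>
  Measurability matters for the exponent \<open>\<infinity>\<close>: the essential supremum of a non-measurable function
  is \<^term>\<open>top\<close> by definition.
\<close>

lemma Lq_norm_mono:
  fixes g :: "real^'n \<Rightarrow> 'a::{real_normed_vector, second_countable_topology}"
    and h :: "real^'n \<Rightarrow> 'b::{real_normed_vector, second_countable_topology}"
  assumes "1 \<le> q" and [measurable]: "g \<in> borel_measurable lebesgue" "h \<in> borel_measurable lebesgue"
    and le: "AE x in lebesgue. norm (g x) \<le> norm (h x)"
  shows "Lq_norm q g \<le> Lq_norm q h"
proof (cases "Lq_norm q h")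
  case (real C)
  show ?thesis
    using assms(1)
  proof (cases q rule: exponent_cases)
    case infinite
    have "AE x in lebesgue. norm (h x) \<le> C"
      using Lq_norm_top_le_iff[of h C] real infinite by simp
    with le have "AE x in lebesgue. norm (g x) \<le> C" by eventually_elim simp
    then show ?thesis using Lq_norm_top_le_iff[of g C] real infinite by simp
  next
    case (finite r)
    have "(\<integral>\<^sup>+x. ennreal (norm (g x) powr r) \<partial>lebesgue) \<le> (\<integral>\<^sup>+x. ennreal (norm (h x) powr r) \<partial>lebesgue)"
      using le finite by (intro nn_integral_mono_AE) (auto intro!: ennreal_leI powr_mono2 elim!: AE_mp)
    also have "\<dots> \<le> ennreal (C powr r)"
      using Lq_norm_finite_le_iff[of r C h] real finite by simp
    finally show ?thesis using Lq_norm_finite_le_iff[of r C g] real finite by simp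
  qed
qed (simp add: top_unique)

lemma AE_lebesgue_affine:
  fixes t :: "'a::euclidean_space"
  assumes "c \<noteq> 0" and [measurable]: "Measurable.pred lebesgue P" and "AE x in lebesgue. P x"
  shows "AE x in lebesgue. P (t + c *\<^sub>R x)"
proof -
  note [measurable] = measurable_lebesgue_affine[OF assms(1), of t]
  let ?u = "\<lambda>x. indicator {x. \<not> P x} x :: ennreal"
  have "(\<integral>\<^sup>+x. ?u x \<partial>lebesgue) = 0"
    using assms(3) by (subst nn_integral_0_iff_AE) (auto simp: indicator_def)
  then have "(\<integral>\<^sup>+x. ?u (t + c *\<^sub>R x) \<partial>lebesgue) = 0"
    using nn_integral_lebesgue_affine[OF assms(1), of ?u t] assms(1) by simp
  then have "AE x in lebesgue. ?u (t + c *\<^sub>R x) = 0"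
    by (subst (asm) nn_integral_0_iff_AE) auto
  then show ?thesis by eventually_elim (auto simp: indicator_def split: if_splits)
qed

lemma Lq_norm_dilation_le:
  fixes h :: "real^'n \<Rightarrow> 'a::{real_normed_vector, second_countable_topology}"
  assumes "1 \<le> q" "0 < b" "0 \<le> C" and [measurable]: "h \<in> borel_measurable lebesgue"
    and le: "Lq_norm q h \<le> ennreal C"
  shows "Lq_norm q (\<lambda>x. a *\<^sub>R h (b *\<^sub>R x)) \<le> ennreal (\<bar>a\<bar> * b powr (- real CARD('n) * recip q) * C)"
  using assms(1)
proof (cases q rule: exponent_cases)
  case infinite
  have meas [measurable]: "(\<lambda>x. h (b *\<^sub>R x)) \<in> borel_measurable lebesgue"
    using measurable_compose[OF measurable_lebesgue_affine[of b 0] assms(4)] assms(2) by simp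
  have "AE x in lebesgue. norm (h x) \<le> C"
    using le infinite assms by (simp add: Lq_norm_top_le_iff)
  then have "AE x in lebesgue. norm (h (0 + b *\<^sub>R x)) \<le> C"
    using assms(2) by (intro AE_lebesgue_affine) auto
  then have "AE x in lebesgue. norm (a *\<^sub>R h (b *\<^sub>R x)) \<le> \<bar>a\<bar> * C"
    by eventually_elim (simp add: mult_left_mono)
  then show ?thesis
    using infinite assms by (simp add: Lq_norm_top_le_iff)
next
  case (finite r)
  have r: "0 < r" using finite by simp
  have meas [measurable]: "(\<lambda>x. h (b *\<^sub>R x)) \<in> borel_measurable lebesgue"
    using measurable_compose[OF measurable_lebesgue_affine[of b 0] assms(4)] assms(2) by simp
  let ?I = "\<integral>\<^sup>+x. ennreal (norm (h x) powr r) \<partial>lebesgue"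
  let ?J = "\<integral>\<^sup>+x. ennreal (norm (h (b *\<^sub>R x)) powr r) \<partial>lebesgue"
  have I: "?I \<le> ennreal (C powr r)" using le finite assms Lq_norm_finite_le_iff[of r C h] by simp
  have IJ: "?I = ennreal (b ^ CARD('n)) * ?J"
    using nn_integral_lebesgue_affine[of b "\<lambda>x. ennreal (norm (h x) powr r)" 0] assms(2) by simp
  have bb: "b powr - real CARD('n) * b ^ CARD('n) = 1"
    using assms(2) by (simp add: powr_minus powr_realpow)
  have "?J = ennreal (b powr - real CARD('n)) * (ennreal (b ^ CARD('n)) * ?J)"
    using bb assms(2) by (simp add: mult.assoc[symmetric] ennreal_mult'[symmetric])
  also have "\<dots> \<le> ennreal (b powr - real CARD('n)) * ennreal (C powr r)"
    unfolding IJ[symmetric] by (intro mult_left_mono I) simp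
  finally have J: "?J \<le> ennreal (b powr - real CARD('n) * C powr r)"
    by (simp add: ennreal_mult')
  have "(\<integral>\<^sup>+x. ennreal (norm (a *\<^sub>R h (b *\<^sub>R x)) powr r) \<partial>lebesgue) = ennreal (\<bar>a\<bar> powr r) * ?J"
    using r by (simp add: powr_mult ennreal_mult' nn_integral_cmult)
  also have "\<dots> \<le> ennreal (\<bar>a\<bar> powr r) * ennreal (b powr - real CARD('n) * C powr r)"
    by (intro mult_left_mono J) simp
  also have "\<dots> = ennreal ((\<bar>a\<bar> * b powr (- real CARD('n) * recip q) * C) powr r)"
    using finite assms by (simp add: ennreal_mult'[symmetric] powr_mult powr_powr)
  finally show ?thesis using finite assms by (simp add: Lq_norm_finite_le_iff)
qed

lemma weight_measurable [measurable]:
  fixes f :: "real^'n \<Rightarrow> 'a::{real_normed_vector, second_countable_topology}"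
  assumes [measurable]: "f \<in> borel_measurable lebesgue"
  shows "(\<lambda>x. (norm x powr s) *\<^sub>R f x) \<in> borel_measurable lebesgue"
proof -
  note [measurable] = lebesgue_borel_ident_measurable
  show ?thesis by measurable
qed

lemma weighted_norm_dilation_le:
  fixes f :: "real^'n \<Rightarrow> 'a::{real_normed_vector, second_countable_topology}"
  assumes "1 \<le> q" "0 < b" "0 \<le> C" and [measurable]: "f \<in> borel_measurable lebesgue"
    and le: "weighted_norm q s f \<le> ennreal C"
  shows "weighted_norm q s (\<lambda>x. a *\<^sub>R f (b *\<^sub>R x))
    \<le> ennreal (\<bar>a\<bar> * b powr (- s - real CARD('n) * recip q) * C)"
proof -
  have "(norm x powr s) *\<^sub>R (a *\<^sub>R f (b *\<^sub>R x))
      = (a * b powr - s) *\<^sub>R ((norm (b *\<^sub>R x) powr s) *\<^sub>R f (b *\<^sub>R x))" for x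
    using assms(2) by (simp add: powr_mult powr_minus field_simps)
  then have "weighted_norm q s (\<lambda>x. a *\<^sub>R f (b *\<^sub>R x))
      = Lq_norm q (\<lambda>x. (a * b powr - s) *\<^sub>R ((\<lambda>z. (norm z powr s) *\<^sub>R f z) (b *\<^sub>R x)))"
    by (simp only: weighted_norm_def)
  also have "\<dots> \<le> ennreal (\<bar>a * b powr - s\<bar> * b powr (- real CARD('n) * recip q) * C)"
    using assms(1-3) le by (intro Lq_norm_dilation_le) (simp_all add: weighted_norm_def)
  also have "\<bar>a * b powr - s\<bar> * b powr (- real CARD('n) * recip q)
      = \<bar>a\<bar> * b powr (- s - real CARD('n) * recip q)"
    by (simp add: abs_mult powr_add[symmetric])
  finally show ?thesis .
qed

text \<open>
  The singular weight belongs to the dual of \<open>L^p\<close>. For \<open>1 < p < \<infinity>\<close> no sharp Hoelder inequality is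
  needed, since \<open>w g \<le> w^p' + g^p\<close> for conjugate exponents suffices on the unit ball of \<open>L^p\<close>.
  For \<open>p = 1\<close> the weight has to be bounded, whence the condition \<open>s \<le> 0\<close>.
\<close>

lemma gauss_weight_duality:
  fixes p :: ennreal
  assumes p: "1 \<le> p" and s: "if p = 1 then s \<le> 0 else s < real CARD('n) * (1 - recip p)"
  obtains A where "0 \<le> A"
    "\<And>G :: real^'n \<Rightarrow> real. G \<in> borel_measurable lebesgue \<Longrightarrow> (\<And>y. 0 \<le> G y) \<Longrightarrow> Lq_norm p G \<le> ennreal 1 \<Longrightarrow>
       (\<integral>\<^sup>+y. ennreal (gauss_weight (- s) y * G y) \<partial>lebesgue) \<le> ennreal A"
  using p
proof (cases p rule: exponent_cases)
  case infinite
  have "(\<integral>\<^sup>+y. ennreal (gauss_weight (- s) (y :: real^'n)) \<partial>lebesgue) < top"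
    using gauss_weight_powr_integrable[of "- s" 1, where 'a="real^'n"] s infinite by simp
  then obtain A where A: "0 \<le> A" "(\<integral>\<^sup>+y. ennreal (gauss_weight (- s) (y :: real^'n)) \<partial>lebesgue) = ennreal A"
    using less_top_ennreal by blast
  have "(\<integral>\<^sup>+y. ennreal (gauss_weight (- s) y * G y) \<partial>lebesgue) \<le> ennreal A"
    if "G \<in> borel_measurable lebesgue" "\<And>y. 0 \<le> G y" "Lq_norm p G \<le> ennreal 1" for G :: "real^'n \<Rightarrow> real"
  proof -
    have "AE y in lebesgue. G y \<le> 1" using that infinite Lq_norm_top_le_iff[of G 1] by simp
    then have "AE y in lebesgue. ennreal (gauss_weight (- s) y * G y) \<le> ennreal (gauss_weight (- s) y)"
      by eventually_elim (auto intro!: ennreal_leI mult_left_le)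
    then show ?thesis unfolding A(2)[symmetric] by (rule nn_integral_mono_AE)
  qed
  with A(1) show ?thesis by (rule that)
next
  case (finite r)
  show ?thesis
  proof (cases "r = 1")
    case True
    with s finite have "0 \<le> - s" by simp
    then obtain C where C: "0 < C" "\<And>x::real^'n. gauss_weight (- s) x \<le> C"
      using gauss_weight_bounded by blast
    have "(\<integral>\<^sup>+y. ennreal (gauss_weight (- s) y * G y) \<partial>lebesgue) \<le> ennreal C"
      if [measurable]: "G \<in> borel_measurable lebesgue" and "\<And>y. 0 \<le> G y" "Lq_norm p G \<le> ennreal 1" for G :: "real^'n \<Rightarrow> real"
    proof -
      have "(\<integral>\<^sup>+y. ennreal (gauss_weight (- s) y * G y) \<partial>lebesgue) \<le> (\<integral>\<^sup>+y. ennreal C * ennreal (G y) \<partial>lebesgue)"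
        using C that by (intro nn_integral_mono) (auto simp: ennreal_mult'[symmetric] intro!: ennreal_leI mult_right_mono)
      also have "\<dots> = ennreal C * (\<integral>\<^sup>+y. ennreal (G y) \<partial>lebesgue)" by (rule nn_integral_cmult) measurable
      also have "\<dots> \<le> ennreal C * 1"
        using that finite True Lq_norm_finite_le_iff[of 1 1 G] by (intro mult_left_mono) auto
      finally show ?thesis by simp
    qed
    with C(1) show ?thesis by (intro that[of C]) auto
  next
    case False
    with finite have r: "1 < r" by simp
    define r' where "r' = r / (r - 1)"
    have r': "0 < r'" "(r' - 1) * (r - 1) = 1" using r by (auto simp: r'_def field_simps)
    have "p \<noteq> 1" using finite False by (metis enn2real_1)
    with s finite have "s < real CARD('n) * (1 - 1 / r)" by simp
    also have "1 - 1 / r = 1 / r'" using r by (simp add: r'_def field_simps)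
    finally have "- real CARD('n) < - s * r'" using r' by (simp add: field_simps)
    then have "(\<integral>\<^sup>+y. ennreal (gauss_weight (- s) (y :: real^'n) powr r') \<partial>lebesgue) < top"
      using r' by (intro gauss_weight_powr_integrable) simp_all
    then obtain A where A: "0 \<le> A" "(\<integral>\<^sup>+y. ennreal (gauss_weight (- s) (y :: real^'n) powr r') \<partial>lebesgue) = ennreal A"
      using less_top_ennreal by blast
    have young: "w * g \<le> w powr r' + g powr r" if "0 \<le> w" "0 \<le> g" for w g :: real
    proof (cases "w = 0 \<or> g = 0")
      case True then show ?thesis by auto
    next
      case False
      with that have pos: "0 < w" "0 < g" by auto
      show ?thesis
      proof (cases "g \<le> w powr (r' - 1)")
        case True
        then have "w * g \<le> w * w powr (r' - 1)" using pos by simp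
        also have "\<dots> = w powr r'" using pos by (simp add: powr_mult_base)
        finally show ?thesis by (simp add: add_increasing2)
      next
        case False
        then have "(w powr (r' - 1)) powr (r - 1) \<le> g powr (r - 1)" using r pos by (intro powr_mono2) auto
        then have "w \<le> g powr (r - 1)" using r' pos by (simp add: powr_powr)
        then have "w * g \<le> g powr (r - 1) * g" using pos by simp
        also have "\<dots> = g powr r" using pos powr_mult_base[of g "r - 1"] by (simp add: mult.commute)
        finally show ?thesis by (simp add: add_increasing)
      qed
    qed
    have "(\<integral>\<^sup>+y. ennreal (gauss_weight (- s) y * G y) \<partial>lebesgue) \<le> ennreal (A + 1)"
      if [measurable]: "G \<in> borel_measurable lebesgue" and "\<And>y. 0 \<le> G y" "Lq_norm p G \<le> ennreal 1" for G :: "real^'n \<Rightarrow> real"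
    proof -
      note [measurable] = lebesgue_borel_ident_measurable
      have "(\<integral>\<^sup>+y. ennreal (gauss_weight (- s) y * G y) \<partial>lebesgue)
        \<le> (\<integral>\<^sup>+y. ennreal (gauss_weight (- s) y powr r') + ennreal (G y powr r) \<partial>lebesgue)"
        using that young by (intro nn_integral_mono) (auto simp: ennreal_plus[symmetric] intro!: ennreal_leI simp del: ennreal_plus)
      also have "\<dots> = ennreal A + (\<integral>\<^sup>+y. ennreal (G y powr r) \<partial>lebesgue)"
        unfolding A(2)[symmetric] by (rule nn_integral_add; measurable)
      also have "\<dots> \<le> ennreal A + ennreal 1"
        using that finite Lq_norm_finite_le_iff[of r 1 G] by (intro add_left_mono) auto
      finally show ?thesis using A by simp
    qed
    with A(1) show ?thesis by (intro that[of "A + 1"]) auto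
  qed
qed

section \<open>Convolution with a bounded integrable kernel\<close>

lemma convolution_integrand_measurable:
  fixes h :: "'a::euclidean_space \<Rightarrow> real" and f :: "'a \<Rightarrow> 'b::{real_normed_vector, second_countable_topology}"
  assumes "h \<in> borel_measurable borel" and "f \<in> borel_measurable lebesgue"
  shows "(\<lambda>z. h (fst z - snd z) *\<^sub>R f (snd z)) \<in> borel_measurable (lebesgue \<Otimes>\<^sub>M lebesgue)"
proof -
  note id = lebesgue_borel_ident_measurable
  have "(\<lambda>z. fst z - snd z) \<in> borel_measurable (lebesgue \<Otimes>\<^sub>M (lebesgue :: 'a measure))"
    by (intro borel_measurable_diff measurable_compose[OF measurable_fst id] measurable_compose[OF measurable_snd id])
  from measurable_compose[OF this assms(1)] measurable_compose[OF measurable_snd assms(2)]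
  show ?thesis by (intro borel_measurable_scaleR) auto
qed

lemma convolution_integrand_section_measurable:
  fixes h :: "'a::euclidean_space \<Rightarrow> real" and f :: "'a \<Rightarrow> 'b::{real_normed_vector, second_countable_topology}"
  assumes "h \<in> borel_measurable borel" and "f \<in> borel_measurable lebesgue"
  shows "(\<lambda>y. h (x - y) *\<^sub>R f y) \<in> borel_measurable lebesgue"
proof -
  have "(\<lambda>y. x - y) \<in> borel_measurable (lebesgue :: 'a measure)"
    by (intro borel_measurable_diff lebesgue_borel_ident_measurable) simp
  from measurable_compose[OF this assms(1)] assms(2) show ?thesis by (intro borel_measurable_scaleR)
qed

lemma nn_integral_reflect:
  fixes h :: "'a::euclidean_space \<Rightarrow> ennreal"
  assumes "h \<in> borel_measurable borel"
  shows "(\<integral>\<^sup>+y. h (x - y) \<partial>lebesgue) = (\<integral>\<^sup>+y. h y \<partial>lebesgue)"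
  using nn_integral_lebesgue_affine[of "-1" h x] measurable_completion[of h lborel borel] assms by simp

lemma nn_integral_translate:
  fixes h :: "'a::euclidean_space \<Rightarrow> ennreal"
  assumes "h \<in> borel_measurable borel"
  shows "(\<integral>\<^sup>+x. h (x - y) \<partial>lebesgue) = (\<integral>\<^sup>+x. h x \<partial>lebesgue)"
  using nn_integral_lebesgue_affine[of 1 h "- y"] measurable_completion[of h lborel borel] assms by simp

text \<open>
  A bounded integrable kernel maps \<open>L^p\<close> into \<open>L^\<infinity>\<close>: use \<open>g \<le> 1 + g^p\<close>, pairing the first term with
  the mass of the kernel and the second with its supremum.
\<close>

lemma convolution_bounded:
  fixes h G :: "real^'n \<Rightarrow> real"
  assumes "1 \<le> p" and h: "h \<in> borel_measurable borel" "\<And>z. 0 \<le> h z" "\<And>z. h z \<le> H"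
    "(\<integral>\<^sup>+z. ennreal (h z) \<partial>lebesgue) \<le> ennreal H"
    and G [measurable]: "G \<in> borel_measurable lebesgue" and G_nonneg: "\<And>y. 0 \<le> G y" and "Lq_norm p G \<le> ennreal 1"
  shows "(\<integral>\<^sup>+y. ennreal (h (x - y) * G y) \<partial>lebesgue) \<le> ennreal (2 * H)"
proof -
  have H: "0 \<le> H" using h(2)[of 0] h(3)[of 0] by linarith
  have m: "(\<lambda>y. ennreal (h (x - y))) \<in> borel_measurable lebesgue"
    using convolution_integrand_section_measurable[OF h(1), of "\<lambda>_. 1 :: real" x] by simp
  have int: "(\<integral>\<^sup>+y. ennreal (h (x - y)) \<partial>lebesgue) \<le> ennreal H"
    using nn_integral_reflect[of "\<lambda>z. ennreal (h z)" x] h by simp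
  show ?thesis
    using assms(1)
  proof (cases p rule: exponent_cases)
    case infinite
    have "AE y in lebesgue. G y \<le> 1" using assms infinite Lq_norm_top_le_iff[of G 1] by simp
    then have "AE y in lebesgue. ennreal (h (x - y) * G y) \<le> ennreal (h (x - y))"
      by eventually_elim (auto intro!: ennreal_leI mult_left_le simp: h)
    then have "(\<integral>\<^sup>+y. ennreal (h (x - y) * G y) \<partial>lebesgue) \<le> (\<integral>\<^sup>+y. ennreal (h (x - y)) \<partial>lebesgue)"
      by (rule nn_integral_mono_AE)
    also have "\<dots> \<le> ennreal H" by (rule int)
    also have "\<dots> \<le> ennreal (2 * H)" using H by (intro ennreal_leI) simp
    finally show ?thesis .
  next
    case (finite r)
    have "h (x - y) * G y \<le> h (x - y) + H * G y powr r" for y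
    proof (cases "G y \<le> 1")
      case True
      then have "h (x - y) * G y \<le> h (x - y)" using h(2) by (intro mult_left_le) auto
      then show ?thesis using H by (simp add: add_increasing2)
    next
      case False
      then have "G y powr 1 \<le> G y powr r" using finite by (intro powr_mono) auto
      then have "h (x - y) * G y \<le> H * G y powr r" using h H False by (intro mult_mono) auto
      then show ?thesis using h(2) by (simp add: add_increasing)
    qed
    then have "(\<integral>\<^sup>+y. ennreal (h (x - y) * G y) \<partial>lebesgue)
        \<le> (\<integral>\<^sup>+y. ennreal (h (x - y)) + ennreal H * ennreal (G y powr r) \<partial>lebesgue)"
      using H h by (intro nn_integral_mono)
        (auto simp: ennreal_plus[symmetric] ennreal_mult'[symmetric] intro!: ennreal_leI simp del: ennreal_plus)
    also have "\<dots> = (\<integral>\<^sup>+y. ennreal (h (x - y)) \<partial>lebesgue) + ennreal H * (\<integral>\<^sup>+y. ennreal (G y powr r) \<partial>lebesgue)"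
      by (rule nn_integral_add_cmult[OF m]) measurable
    also have "\<dots> \<le> ennreal H + ennreal H * ennreal 1"
      using int assms finite Lq_norm_finite_le_iff[of r 1 G] by (intro add_mono mult_left_mono) auto
    also have "\<dots> = ennreal (2 * H)" using H by (simp add: ennreal_plus[symmetric] del: ennreal_plus)
    finally show ?thesis .
  qed
qed

text \<open>
  A form of Jensen's inequality with a lossy constant. The bound \<open>g \<le> l + l^(1-r) g^r\<close> holds for every
  \<open>l > 0\<close>; integrating it against \<open>h\<close> with \<open>l = v/(2H)\<close>, the first term accounts for at most half of
  \<open>v\<close> and can be absorbed.
\<close>

lemma powr_mean_le:
  fixes h g :: "'a \<Rightarrow> real"
  assumes r: "1 \<le> r" and H: "1 \<le> H" and [measurable]: "h \<in> borel_measurable M" "g \<in> borel_measurable M"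
    and nonneg: "\<And>y. 0 \<le> h y" "\<And>y. 0 \<le> g y"
    and mass: "(\<integral>\<^sup>+y. ennreal (h y) \<partial>M) \<le> ennreal H" and v: "(\<integral>\<^sup>+y. ennreal (h y * g y) \<partial>M) = ennreal v" "0 \<le> v"
  shows "ennreal (v powr r) \<le> ennreal ((2 * H) powr r) * (\<integral>\<^sup>+y. ennreal (h y * g y powr r) \<partial>M)"
proof (cases "v = 0")
  case False
  with v have "0 < v" by simp
  \<comment> \<open>This choice makes \<open>l * H\<close> equal to half of \<open>v\<close>.\<close>
  define l where "l = v / (2 * H)"
  have l: "0 < l" "v = 2 * H * l" using \<open>0 < v\<close> H by (auto simp: l_def)
  show ?thesis
  proof (cases "\<integral>\<^sup>+y. ennreal (h y * g y powr r) \<partial>M")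
    case (real i)
    have pt: "g y \<le> l + l powr (1 - r) * g y powr r" for y
    proof (cases "g y \<le> l")
      case True then show ?thesis by (simp add: add_increasing2)
    next
      case False
      then have "g y powr (1 - r) \<le> l powr (1 - r)" using l r by (intro powr_mono2') auto
      then have "g y powr (1 - r) * g y powr r \<le> l powr (1 - r) * g y powr r" by (intro mult_right_mono) auto
      moreover have "g y powr (1 - r) * g y powr r = g y" using False l by (simp add: powr_add[symmetric])
      ultimately show ?thesis using l by simp
    qed
    have "h y * g y \<le> l * h y + l powr (1 - r) * (h y * g y powr r)" for y
      using mult_left_mono[OF pt[of y] nonneg(1)[of y]] by (simp add: algebra_simps)
    then have "ennreal v \<le> (\<integral>\<^sup>+y. ennreal l * ennreal (h y) + ennreal (l powr (1 - r)) * ennreal (h y * g y powr r) \<partial>M)"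
      unfolding v(1)[symmetric] using l nonneg by (intro nn_integral_mono)
        (auto simp: ennreal_plus[symmetric] ennreal_mult'[symmetric] intro!: ennreal_leI simp del: ennreal_plus)
    also have "\<dots> = ennreal l * (\<integral>\<^sup>+y. ennreal (h y) \<partial>M) + ennreal (l powr (1 - r)) * (\<integral>\<^sup>+y. ennreal (h y * g y powr r) \<partial>M)"
      by (simp add: nn_integral_add nn_integral_cmult)
    also have "\<dots> \<le> ennreal l * ennreal H + ennreal (l powr (1 - r)) * ennreal i"
      unfolding real(2) by (intro add_mono mult_left_mono mass) auto
    also have "\<dots> = ennreal (l * H + l powr (1 - r) * i)"
      using l H real by (simp add: ennreal_plus ennreal_mult')
    finally have "v \<le> l * H + l powr (1 - r) * i"
      using l H real by (subst (asm) ennreal_le_iff) auto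
    then have "l * H \<le> l powr (1 - r) * i" using l by (simp add: mult.commute)
    then have "l powr (r - 1) * (l * H) \<le> l powr (r - 1) * (l powr (1 - r) * i)"
      by (intro mult_left_mono) auto
    moreover have "l powr (r - 1) * (l * H) = l powr r * H"
      using l powr_mult_base[of l "r - 1"] by (simp add: mult_ac)
    moreover have "l powr (r - 1) * (l powr (1 - r) * i) = i"
      using l by (simp add: mult.assoc[symmetric] powr_add[symmetric])
    ultimately have "l powr r * H \<le> i" by simp
    moreover have "l powr r * 1 \<le> l powr r * H" using H by (intro mult_left_mono) auto
    ultimately have "l powr r \<le> i" by linarith
    then have "(2 * H) powr r * l powr r \<le> (2 * H) powr r * i" by (intro mult_left_mono) auto
    also have "(2 * H) powr r * l powr r = v powr r" using l H by (simp add: powr_mult)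
    finally show ?thesis using real by (simp add: ennreal_mult'[symmetric] ennreal_leI)
  next
    case top
    then show ?thesis using H by (simp add: ennreal_mult_eq_top_iff)
  qed
qed simp

text \<open>
  Young's inequality for the pair \<open>r \<le> Q\<close>, by interpolation between \<open>L^r\<close> and \<open>L^\<infinity>\<close>: the extra power
  \<open>Q - r\<close> of the convolution is estimated by its supremum, and the power \<open>r\<close> is integrated by
  Tonelli.
\<close>

lemma convolution_powr_integral_le:
  fixes h G :: "real^'n \<Rightarrow> real"
  assumes r: "1 \<le> r" and H: "1 \<le> H" and rQ: "r \<le> Q"
    and h: "h \<in> borel_measurable borel" "\<And>z. 0 \<le> h z" "\<And>z. h z \<le> H"
    "(\<integral>\<^sup>+z. ennreal (h z) \<partial>lebesgue) \<le> ennreal H"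
    and G [measurable]: "G \<in> borel_measurable lebesgue" and G_nonneg: "\<And>y. 0 \<le> G y"
    and norm: "Lq_norm (ennreal r) G \<le> ennreal 1"
    and V: "\<And>x. (\<integral>\<^sup>+y. ennreal (h (x - y) * G y) \<partial>lebesgue) = ennreal (V x)" "\<And>x. 0 \<le> V x"
  shows "(\<integral>\<^sup>+x. ennreal (V x powr Q) \<partial>lebesgue) \<le> ennreal ((2 * H) powr Q * H)"
proof -
  let ?I = "\<lambda>x. \<integral>\<^sup>+y. ennreal (h (x - y) * G y powr r) \<partial>lebesgue"
  have G_int: "(\<integral>\<^sup>+y. ennreal (G y powr r) \<partial>lebesgue) \<le> 1"
    using norm G_nonneg r Lq_norm_finite_le_iff[of r 1 G] by simp
  have V_le: "V x \<le> 2 * H" for x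
    using convolution_bounded[of "ennreal r" h H G x] assms by simp
  have mh: "(\<lambda>y. h (x - y)) \<in> borel_measurable lebesgue" for x
    using convolution_integrand_section_measurable[OF h(1), of "\<lambda>_. 1 :: real" x] by simp
  have mpair [measurable]: "(\<lambda>(x, y). ennreal (h (x - y) * G y powr r)) \<in> borel_measurable (lebesgue \<Otimes>\<^sub>M lebesgue)"
    using measurable_compose[OF convolution_integrand_measurable[OF h(1), of "\<lambda>y. G y powr r"] measurable_ennreal]
    by (simp add: case_prod_beta)
  have int_h: "(\<integral>\<^sup>+x. ennreal (h (x - y)) \<partial>lebesgue) \<le> ennreal H" for y
    using nn_integral_translate[of "\<lambda>z. ennreal (h z)" y] h by simp
  have mh': "(\<lambda>x. ennreal (h (x - y))) \<in> borel_measurable lebesgue" for y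
    by (intro measurable_completion) (use h(1) in measurable)
  have I_int: "(\<integral>\<^sup>+x. ?I x \<partial>lebesgue) \<le> ennreal H"
  proof -
    have "(\<integral>\<^sup>+x. ?I x \<partial>lebesgue) = (\<integral>\<^sup>+y. \<integral>\<^sup>+x. ennreal (h (x - y) * G y powr r) \<partial>lebesgue \<partial>lebesgue)"
      by (rule lebesgue_pair.Fubini'[symmetric]) (rule mpair)
    also have "\<dots> = (\<integral>\<^sup>+y. (\<integral>\<^sup>+x. ennreal (h (x - y)) \<partial>lebesgue) * ennreal (G y powr r) \<partial>lebesgue)"
      using h by (simp add: ennreal_mult nn_integral_multc[OF mh'])
    also have "\<dots> \<le> (\<integral>\<^sup>+y. ennreal H * ennreal (G y powr r) \<partial>lebesgue)"
      by (intro nn_integral_mono mult_right_mono int_h) auto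
    also have "\<dots> = ennreal H * (\<integral>\<^sup>+y. ennreal (G y powr r) \<partial>lebesgue)" by (rule nn_integral_cmult) measurable
    also have "\<dots> \<le> ennreal H * 1" by (intro mult_left_mono G_int) auto
    finally show ?thesis by simp
  qed
  have "ennreal (V x powr Q) \<le> ennreal ((2 * H) powr Q) * ?I x" for x
  proof -
    have "V x powr Q = V x powr (Q - r) * V x powr r" by (simp add: powr_add[symmetric])
    also have "\<dots> \<le> (2 * H) powr (Q - r) * V x powr r"
      using V V_le rQ by (intro mult_right_mono powr_mono2) auto
    finally have "ennreal (V x powr Q) \<le> ennreal ((2 * H) powr (Q - r)) * ennreal (V x powr r)"
      by (simp add: ennreal_mult'[symmetric] ennreal_leI)
    also have "\<dots> \<le> ennreal ((2 * H) powr (Q - r)) * (ennreal ((2 * H) powr r) * ?I x)"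
    proof (intro mult_left_mono powr_mean_le)
      show "(\<integral>\<^sup>+y. ennreal (h (x - y)) \<partial>lebesgue) \<le> ennreal H"
        using nn_integral_reflect[of "\<lambda>z. ennreal (h z)" x] h by simp
    qed (use assms mh in auto)
    also have "\<dots> = ennreal ((2 * H) powr Q) * ?I x"
      by (simp add: mult.assoc[symmetric] ennreal_mult'[symmetric] powr_add[symmetric])
    finally show ?thesis .
  qed
  then have "(\<integral>\<^sup>+x. ennreal (V x powr Q) \<partial>lebesgue) \<le> (\<integral>\<^sup>+x. ennreal ((2 * H) powr Q) * ?I x \<partial>lebesgue)"
    by (intro nn_integral_mono)
  also have "\<dots> = ennreal ((2 * H) powr Q) * (\<integral>\<^sup>+x. ?I x \<partial>lebesgue)"
    by (rule nn_integral_cmult) (rule lebesgue.borel_measurable_nn_integral[OF mpair])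
  also have "\<dots> \<le> ennreal ((2 * H) powr Q) * ennreal H" by (intro mult_left_mono I_int) auto
  finally show ?thesis by (simp add: ennreal_mult'[symmetric])
qed

section \<open>The heat flow at unit time\<close>

lemma heat_kernel_unit: "heat_kernel 1 (z :: real^'n) = (4 * pi) powr (- real CARD('n) / 2) * exp (- (norm z)\<^sup>2 / 4)"
  by (simp add: heat_kernel_def)

lemma heat_kernel_measurable [measurable]: "heat_kernel t \<in> borel_measurable borel"
  unfolding heat_kernel_def by measurable

lemma heat_kernel_nonneg [simp]: "0 \<le> heat_kernel t z"
  by (simp add: heat_kernel_def)

lemma heat_measurable:
  fixes f :: "real^'n \<Rightarrow> 'a::euclidean_space"
  assumes "f \<in> borel_measurable lebesgue"
  shows "heat t f \<in> borel_measurable lebesgue"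
proof -
  have "(\<lambda>(x, y). heat_kernel t (x - y) *\<^sub>R f y) \<in> borel_measurable (lebesgue \<Otimes>\<^sub>M lebesgue)"
    using convolution_integrand_measurable[OF heat_kernel_measurable assms] by (simp add: case_prod_beta)
  then have "(\<lambda>x. \<integral>y. heat_kernel t (x - y) *\<^sub>R f y \<partial>lebesgue) \<in> borel_measurable lebesgue"
    by (rule lebesgue.borel_measurable_lebesgue_integral)
  then show ?thesis by (simp add: heat_def[abs_def])
qed

text \<open>
  The kernel splitting, integrated against \<open>|f| = |y|^(-s) G\<close>. The right-hand side is a rank-one
  operator plus a convolution, both applied to the weighted function \<open>G\<close>.
\<close>

lemma weighted_heat_integral_le:
  fixes f :: "real^'n \<Rightarrow> 'a::euclidean_space"
  assumes "s' \<le> s" and f: "f \<in> borel_measurable lebesgue"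
    and G_def: "G = (\<lambda>y. norm y powr s * norm (f y))"
  shows "ennreal (norm x powr s') * (\<integral>\<^sup>+y. ennreal (norm (heat_kernel 1 (x - y) *\<^sub>R f y)) \<partial>lebesgue)
    \<le> ennreal ((4 * pi) powr (- real CARD('n) / 2)) *
       (ennreal (exp (3/8) * gauss_weight s' x) * (\<integral>\<^sup>+y. ennreal (gauss_weight (- s) y * G y) \<partial>lebesgue)
        + (\<integral>\<^sup>+y. ennreal (moment_kernel \<bar>s\<bar> (x - y) * G y) \<partial>lebesgue))"
proof -
  let ?k = "(4 * pi) powr (- real CARD('n) / 2)"
  note [measurable] = lebesgue_borel_ident_measurable f
  have mG [measurable]: "G \<in> borel_measurable lebesgue" unfolding G_def by measurable
  have m1: "(\<lambda>y. ennreal (norm (heat_kernel 1 (x - y) *\<^sub>R f y))) \<in> borel_measurable lebesgue"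
    using convolution_integrand_section_measurable[OF heat_kernel_measurable f, of 1 x] by measurable
  have m2: "(\<lambda>y. ennreal (moment_kernel \<bar>s\<bar> (x - y) * G y)) \<in> borel_measurable lebesgue"
    using convolution_integrand_section_measurable[OF moment_kernel_measurable mG, of "\<bar>s\<bar>" x] by simp
  have "ennreal (norm x powr s') * (\<integral>\<^sup>+y. ennreal (norm (heat_kernel 1 (x - y) *\<^sub>R f y)) \<partial>lebesgue)
      = (\<integral>\<^sup>+y. ennreal (norm x powr s') * ennreal (norm (heat_kernel 1 (x - y) *\<^sub>R f y)) \<partial>lebesgue)"
    by (rule nn_integral_cmult[symmetric, OF m1])
  also have "\<dots> \<le> (\<integral>\<^sup>+y. ennreal ?k * (ennreal (exp (3/8) * gauss_weight s' x) * ennreal (gauss_weight (- s) y * G y)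
        + ennreal (moment_kernel \<bar>s\<bar> (x - y) * G y)) \<partial>lebesgue)"
  proof (rule nn_integral_mono_AE)
    show "AE y in lebesgue. ennreal (norm x powr s') * ennreal (norm (heat_kernel 1 (x - y) *\<^sub>R f y))
      \<le> ennreal ?k * (ennreal (exp (3/8) * gauss_weight s' x) * ennreal (gauss_weight (- s) y * G y)
        + ennreal (moment_kernel \<bar>s\<bar> (x - y) * G y))"
      using AE_lebesgue_neq[of 0]
    proof eventually_elim
      case (elim y)
      have "norm (f y) = norm y powr - s * G y" using elim by (simp add: G_def powr_minus)
      then have "norm x powr s' * norm (heat_kernel 1 (x - y) *\<^sub>R f y)
          = ?k * ((norm x powr s' * exp (- (norm (x - y))\<^sup>2 / 4) * norm y powr - s) * G y)"
        by (simp add: heat_kernel_unit abs_mult)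
      also have "\<dots> \<le> ?k * ((exp (3/8) * gauss_weight s' x * gauss_weight (- s) y + moment_kernel \<bar>s\<bar> (x - y)) * G y)"
        using assms(1) by (intro mult_left_mono mult_right_mono weighted_gauss_splitting) (auto simp: G_def)
      also have "\<dots> = ?k * (exp (3/8) * gauss_weight s' x * (gauss_weight (- s) y * G y) + moment_kernel \<bar>s\<bar> (x - y) * G y)"
        by (simp add: algebra_simps)
      finally have "ennreal (norm x powr s' * norm (heat_kernel 1 (x - y) *\<^sub>R f y)) \<le> ennreal \<dots>"
        by (rule ennreal_leI)
      then show ?case
        by (simp add: G_def ennreal_mult ennreal_plus)
    qed
  qed
  also have "\<dots> = ennreal ?k * (\<integral>\<^sup>+y. ennreal (moment_kernel \<bar>s\<bar> (x - y) * G y) +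
        ennreal (exp (3/8) * gauss_weight s' x) * ennreal (gauss_weight (- s) y * G y) \<partial>lebesgue)"
    using m2 by (subst nn_integral_cmult) (auto simp: add.commute)
  also have "(\<integral>\<^sup>+y. ennreal (moment_kernel \<bar>s\<bar> (x - y) * G y) +
        ennreal (exp (3/8) * gauss_weight s' x) * ennreal (gauss_weight (- s) y * G y) \<partial>lebesgue)
      = (\<integral>\<^sup>+y. ennreal (moment_kernel \<bar>s\<bar> (x - y) * G y) \<partial>lebesgue) +
        ennreal (exp (3/8) * gauss_weight s' x) * (\<integral>\<^sup>+y. ennreal (gauss_weight (- s) y * G y) \<partial>lebesgue)"
    by (rule nn_integral_add_cmult[OF m2]) measurable
  finally show ?thesis by (simp add: add.commute)
qed

lemma powr_sum_le:
  fixes a b r :: real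
  assumes "0 \<le> a" "0 \<le> b" "0 \<le> r"
  shows "(a + b) powr r \<le> 2 powr r * (a powr r + b powr r)"
proof -
  have "(a + b) powr r \<le> (2 * max a b) powr r" using assms by (intro powr_mono2) auto
  also have "\<dots> = 2 powr r * max a b powr r" using assms by (simp add: powr_mult)
  also have "\<dots> \<le> 2 powr r * (a powr r + b powr r)" by (intro mult_left_mono) (auto simp: max_def)
  finally show ?thesis .
qed

text \<open>
  The majorant consists of a multiple of the weight \<open>|x|^s' exp(-|x|\<^sup>2/8)\<close>, which lies in \<open>L^q\<close> by the
  lower bound on \<open>s'\<close>, and of a convolution \<open>V = h * G\<close>. The constant must not depend on \<open>G\<close>.
\<close>

lemma Lq_norm_majorant_bounded:
  fixes p q :: ennreal
  assumes pq: "1 \<le> p" "p \<le> q" and s': "if q = top then 0 \<le> s' else - real CARD('n) * recip q < s'"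
    and A: "0 \<le> A" and H: "1 \<le> H" and k: "0 \<le> k"
    and h: "h \<in> borel_measurable borel" "\<And>z::real^'n. 0 \<le> h z" "\<And>z. h z \<le> H"
    "(\<integral>\<^sup>+z. ennreal (h z) \<partial>lebesgue) \<le> ennreal H"
  obtains C where "0 < C"
    "\<And>G V :: real^'n \<Rightarrow> real. G \<in> borel_measurable lebesgue \<Longrightarrow> (\<And>y. 0 \<le> G y) \<Longrightarrow> Lq_norm p G \<le> ennreal 1 \<Longrightarrow>
       V \<in> borel_measurable lebesgue \<Longrightarrow> (\<And>x. 0 \<le> V x) \<Longrightarrow>
       (\<And>x. (\<integral>\<^sup>+y. ennreal (h (x - y) * G y) \<partial>lebesgue) = ennreal (V x)) \<Longrightarrow>
       Lq_norm q (\<lambda>x. k * (A * gauss_weight s' x + V x)) \<le> ennreal C"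
proof -
  note meas = lebesgue_borel_ident_measurable
  have "1 \<le> q" using pq by (rule order_trans)
  then show ?thesis
  proof (cases q rule: exponent_cases)
    case infinite
    with s' have "0 \<le> s'" by simp
    then obtain U where U: "0 < U" "\<And>x::real^'n. gauss_weight s' x \<le> U" using gauss_weight_bounded by blast
    let ?C = "k * (A * U + 2 * H)"
    have C: "0 \<le> ?C" using A k U H by simp
    have "Lq_norm q (\<lambda>x. k * (A * gauss_weight s' x + V x)) \<le> ennreal (?C + 1)"
      if G: "G \<in> borel_measurable lebesgue" "\<And>y. 0 \<le> G y" "Lq_norm p G \<le> ennreal 1"
        and [measurable]: "V \<in> borel_measurable lebesgue" and V: "\<And>x. 0 \<le> V x"
        "\<And>x. (\<integral>\<^sup>+y. ennreal (h (x - y) * G y) \<partial>lebesgue) = ennreal (V x)" for G V :: "real^'n \<Rightarrow> real"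
    proof -
      note [measurable] = meas
      have "norm (k * (A * gauss_weight s' x + V x)) \<le> ?C + 1" for x
      proof -
        have "V x \<le> 2 * H"
          using convolution_bounded[OF pq(1) h G, of x] V[of x] H by simp
        then have "k * (A * gauss_weight s' x + V x) \<le> ?C"
          using U A k by (intro mult_left_mono add_mono) auto
        moreover have "0 \<le> k * (A * gauss_weight s' x + V x)" using V A k by simp
        ultimately show ?thesis by simp
      qed
      then show ?thesis using infinite C by (subst infinite(1), subst Lq_norm_top_le_iff) auto
    qed
    with C show ?thesis by (intro that[of "?C + 1"]) auto
  next
    case (finite Q)
    have "p \<noteq> top" using pq finite by (auto simp: top_unique)
    with pq(1) obtain r where r: "1 \<le> r" "p = ennreal r" by (metis exponent_cases)
    have rQ: "r \<le> Q" using pq r finite by simp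
    have "- real CARD('n) * (1 / Q) < s'" using s' finite by metis
    then have "- real CARD('n) < s' * Q" using finite(1) by (simp add: field_simps)
    then have "(\<integral>\<^sup>+x. ennreal (gauss_weight s' (x::real^'n) powr Q) \<partial>lebesgue) < top"
      using finite by (intro gauss_weight_powr_integrable) auto
    then obtain B where B: "0 \<le> B" "(\<integral>\<^sup>+x. ennreal (gauss_weight s' (x::real^'n) powr Q) \<partial>lebesgue) = ennreal B"
      using less_top_ennreal by blast
    \<comment> \<open>The bound for the integral of the \<open>Q\<close>-th power of the majorant.\<close>
    define X where "X = (2 * k) powr Q * (A powr Q * B + (2 * H) powr Q * H)"
    have X: "0 \<le> X" using B H by (simp add: X_def)
    define C where "C = X powr (1 / Q)"
    have C: "0 \<le> C" "C powr Q = X" using X finite by (auto simp: C_def powr_powr)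
    have "Lq_norm q (\<lambda>x. k * (A * gauss_weight s' x + V x)) \<le> ennreal (C + 1)"
      if G: "G \<in> borel_measurable lebesgue" "\<And>y. 0 \<le> G y" "Lq_norm p G \<le> ennreal 1"
        and [measurable]: "V \<in> borel_measurable lebesgue" and V: "\<And>x. 0 \<le> V x"
        "\<And>x. (\<integral>\<^sup>+y. ennreal (h (x - y) * G y) \<partial>lebesgue) = ennreal (V x)" for G V :: "real^'n \<Rightarrow> real"
    proof -
      note [measurable] = meas
      have VQ: "(\<integral>\<^sup>+x. ennreal (V x powr Q) \<partial>lebesgue) \<le> ennreal ((2 * H) powr Q * H)"
        using G V by (intro convolution_powr_integral_le[OF r(1) H rQ h]) (auto simp: r)
      have pt: "norm (k * (A * gauss_weight s' x + V x)) powr Q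
          \<le> (2 * k) powr Q * (A powr Q * gauss_weight s' x powr Q + V x powr Q)" for x
      proof -
        have "norm (k * (A * gauss_weight s' x + V x)) powr Q = k powr Q * (A * gauss_weight s' x + V x) powr Q"
          using A k V(1)[of x] by (simp add: abs_mult powr_mult)
        also have "\<dots> \<le> k powr Q * (2 powr Q * ((A * gauss_weight s' x) powr Q + V x powr Q))"
          using A V(1)[of x] finite by (intro mult_left_mono powr_sum_le) auto
        finally show ?thesis using A k by (simp add: powr_mult mult_ac)
      qed
      have "(\<integral>\<^sup>+x. ennreal (norm (k * (A * gauss_weight s' x + V x)) powr Q) \<partial>lebesgue)
         \<le> (\<integral>\<^sup>+x. ennreal ((2 * k) powr Q) * (ennreal (V x powr Q) + ennreal (A powr Q) * ennreal (gauss_weight s' x powr Q)) \<partial>lebesgue)"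
      proof (rule nn_integral_mono)
        fix x :: "real^'n"
        have "ennreal (norm (k * (A * gauss_weight s' x + V x)) powr Q)
          \<le> ennreal ((2 * k) powr Q * (A powr Q * gauss_weight s' x powr Q + V x powr Q))"
          by (intro ennreal_leI pt)
        then show "ennreal (norm (k * (A * gauss_weight s' x + V x)) powr Q)
          \<le> ennreal ((2 * k) powr Q) * (ennreal (V x powr Q) + ennreal (A powr Q) * ennreal (gauss_weight s' x powr Q))"
          by (simp add: ennreal_mult ennreal_plus add.commute)
      qed
      also have "\<dots> = ennreal ((2 * k) powr Q) * (\<integral>\<^sup>+x. ennreal (V x powr Q) + ennreal (A powr Q) * ennreal (gauss_weight s' x powr Q) \<partial>lebesgue)"
        by (rule nn_integral_cmult; measurable)
      also have "(\<integral>\<^sup>+x. ennreal (V x powr Q) + ennreal (A powr Q) * ennreal (gauss_weight s' x powr Q) \<partial>lebesgue)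
        = (\<integral>\<^sup>+x. ennreal (V x powr Q) \<partial>lebesgue) + ennreal (A powr Q) * ennreal B"
        unfolding B(2)[symmetric] by (rule nn_integral_add_cmult; measurable)
      also have "ennreal ((2 * k) powr Q) * ((\<integral>\<^sup>+x. ennreal (V x powr Q) \<partial>lebesgue) + ennreal (A powr Q) * ennreal B)
        \<le> ennreal ((2 * k) powr Q) * (ennreal ((2 * H) powr Q * H) + ennreal (A powr Q) * ennreal B)"
        by (intro mult_left_mono add_mono VQ) auto
      also have "\<dots> = ennreal X"
        using B H by (simp add: X_def ennreal_mult ennreal_plus add.commute)
      finally have "Lq_norm q (\<lambda>x. k * (A * gauss_weight s' x + V x)) \<le> ennreal C"
        using finite C by (simp add: Lq_norm_finite_le_iff)
      also have "\<dots> \<le> ennreal (C + 1)" by (intro ennreal_leI) simp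
      finally show ?thesis .
    qed
    with C show ?thesis by (intro that[of "C + 1"]) auto
  qed
qed

text \<open>
  The integral converges at every point except possibly the origin, where the weight vanishes by
  convention and the weighted bound is void.
\<close>

lemma heat_unit_time_bounded:
  fixes p q :: ennreal
  assumes pq: "1 \<le> p" "p \<le> q" and adm: "admissible CARD('n) p q s s'"
  obtains C where "0 < C"
    "\<And>f :: real^'n \<Rightarrow> 'a::euclidean_space. f \<in> borel_measurable lebesgue \<Longrightarrow> weighted_norm p s f \<le> ennreal 1 \<Longrightarrow>
      weighted_norm q s' (heat 1 f) \<le> ennreal C"
    "\<And>(f :: real^'n \<Rightarrow> 'a) x. f \<in> borel_measurable lebesgue \<Longrightarrow> weighted_norm p s f \<le> ennreal 1 \<Longrightarrow> x \<noteq> 0 \<Longrightarrow>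
      integrable lebesgue (\<lambda>y. heat_kernel 1 (x - y) *\<^sub>R f y)"
proof -
  have s: "if q = top then 0 \<le> s' else - real CARD('n) * recip q < s'" "s' \<le> s"
    "if p = 1 then s \<le> 0 else s < real CARD('n) * (1 - recip p)"
    using adm by (auto simp: admissible_def)
  obtain A where A: "0 \<le> A"
    "\<And>G :: real^'n \<Rightarrow> real. G \<in> borel_measurable lebesgue \<Longrightarrow> (\<And>y. 0 \<le> G y) \<Longrightarrow> Lq_norm p G \<le> ennreal 1 \<Longrightarrow>
       (\<integral>\<^sup>+y. ennreal (gauss_weight (- s) y * G y) \<partial>lebesgue) \<le> ennreal A"
    using gauss_weight_duality[OF pq(1) s(3)] by blast
  obtain H where H: "1 \<le> H" "\<And>z::real^'n. moment_kernel \<bar>s\<bar> z \<le> H"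
    "(\<integral>\<^sup>+z. ennreal (moment_kernel \<bar>s\<bar> (z::real^'n)) \<partial>lebesgue) \<le> ennreal H"
    using moment_kernel_bounded[of "\<bar>s\<bar>", where 'a="real^'n"] by auto
  define k where "k = (4 * pi) powr (- real CARD('n) / 2)"
  define B where "B = exp (3/8) * A"
  have B: "0 \<le> B" using A by (simp add: B_def)
  have k: "0 \<le> k" by (simp add: k_def)
  obtain C where C: "0 < C"
    "\<And>G V :: real^'n \<Rightarrow> real. G \<in> borel_measurable lebesgue \<Longrightarrow> (\<And>y. 0 \<le> G y) \<Longrightarrow> Lq_norm p G \<le> ennreal 1 \<Longrightarrow>
       V \<in> borel_measurable lebesgue \<Longrightarrow> (\<And>x. 0 \<le> V x) \<Longrightarrow>
       (\<And>x. (\<integral>\<^sup>+y. ennreal (moment_kernel \<bar>s\<bar> (x - y) * G y) \<partial>lebesgue) = ennreal (V x)) \<Longrightarrow>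
       Lq_norm q (\<lambda>x. k * (B * gauss_weight s' x + V x)) \<le> ennreal C"
    using Lq_norm_majorant_bounded[OF pq s(1) B H(1) k moment_kernel_measurable moment_kernel_nonneg H(2,3)]
    by blast
  have main: "weighted_norm q s' (heat 1 f) \<le> ennreal C \<and>
      (\<forall>x. x \<noteq> 0 \<longrightarrow> integrable lebesgue (\<lambda>y. heat_kernel 1 (x - y) *\<^sub>R f y))"
    if f [measurable]: "f \<in> borel_measurable lebesgue" and norm_f: "weighted_norm p s f \<le> ennreal 1"
    for f :: "real^'n \<Rightarrow> 'a"
  proof -
    note [measurable] = lebesgue_borel_ident_measurable
    define G where "G = (\<lambda>y. norm y powr s * norm (f y))"
    have mG [measurable]: "G \<in> borel_measurable lebesgue" unfolding G_def by measurable
    have G0: "0 \<le> G y" for y by (simp add: G_def)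
    have "Lq_norm p G \<le> Lq_norm p (\<lambda>y. (norm y powr s) *\<^sub>R f y)"
      using f by (intro Lq_norm_mono pq mG weight_measurable) (auto simp: G_def)
    also have "\<dots> \<le> ennreal 1" using norm_f by (simp only: weighted_norm_def)
    finally have normG: "Lq_norm p G \<le> ennreal 1" .
    let ?v = "\<lambda>x. \<integral>\<^sup>+y. ennreal (moment_kernel \<bar>s\<bar> (x - y) * G y) \<partial>lebesgue"
    define V where "V = (\<lambda>x. enn2real (?v x))"
    have "?v x \<le> ennreal (2 * H)" for x
      by (intro convolution_bounded[OF pq(1)] normG mG G0 H moment_kernel_measurable moment_kernel_nonneg)
    then have "?v x < top" for x by (rule le_less_trans) simp
    then have v: "?v x = ennreal (V x)" for x by (simp add: V_def)
    have V0: "0 \<le> V x" for x by (simp add: V_def)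
    have "(\<lambda>(x, y). ennreal (moment_kernel \<bar>s\<bar> (x - y) * G y)) \<in> borel_measurable (lebesgue \<Otimes>\<^sub>M lebesgue)"
      using measurable_compose[OF convolution_integrand_measurable[OF moment_kernel_measurable mG] measurable_ennreal]
      by (simp add: case_prod_beta)
    then have "?v \<in> borel_measurable lebesgue" by (rule lebesgue.borel_measurable_nn_integral)
    then have mV [measurable]: "V \<in> borel_measurable lebesgue" unfolding V_def by measurable
    define D where "D = (\<lambda>x. k * (B * gauss_weight s' x + V x))"
    have D0: "0 \<le> D x" for x using k B V0 by (simp add: D_def)
    let ?I = "\<lambda>x. \<integral>\<^sup>+y. ennreal (norm (heat_kernel 1 (x - y) *\<^sub>R f y)) \<partial>lebesgue"
    have I_le: "ennreal (norm x powr s') * ?I x \<le> ennreal (D x)" for x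
    proof -
      have "ennreal (norm x powr s') * ?I x \<le> ennreal k *
        (ennreal (exp (3/8) * gauss_weight s' x) * (\<integral>\<^sup>+y. ennreal (gauss_weight (- s) y * G y) \<partial>lebesgue) + ?v x)"
        unfolding k_def by (rule weighted_heat_integral_le[OF s(2) f G_def])
      also have "\<dots> \<le> ennreal k * (ennreal (exp (3/8) * gauss_weight s' x) * ennreal A + ennreal (V x))"
        unfolding v by (intro mult_left_mono add_mono A(2) mG G0 normG) auto
      also have "\<dots> = ennreal (D x)"
        using A k V0 by (simp add: D_def B_def ennreal_mult ennreal_plus mult_ac)
      finally show ?thesis .
    qed
    have mint: "(\<lambda>y. heat_kernel 1 (x - y) *\<^sub>R f y) \<in> borel_measurable lebesgue" for x
      by (rule convolution_integrand_section_measurable[OF heat_kernel_measurable f])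
    have int: "integrable lebesgue (\<lambda>y. heat_kernel 1 (x - y) *\<^sub>R f y)" if "x \<noteq> 0" for x
    proof (rule integrableI_bounded[OF mint])
      have "ennreal (norm x powr s') \<noteq> 0" using that by simp
      moreover have "ennreal (norm x powr s') * ?I x \<noteq> top" using I_le[of x] by (auto simp: top_unique)
      ultimately show "?I x < \<infinity>" by (auto simp: ennreal_mult_eq_top_iff less_top[symmetric])
    qed
    have le: "norm ((norm x powr s') *\<^sub>R heat 1 f x) \<le> norm (D x)" if "x \<noteq> 0" for x
    proof -
      have "ennreal (norm ((norm x powr s') *\<^sub>R heat 1 f x)) = ennreal (norm x powr s') * ennreal (norm (heat 1 f x))"
        by (simp add: ennreal_mult)
      also have "\<dots> \<le> ennreal (norm x powr s') * ?I x"
        unfolding heat_def by (intro mult_left_mono integral_norm_bound_ennreal int that) auto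
      also note I_le
      finally show ?thesis using D0[of x] by simp
    qed
    have mD: "D \<in> borel_measurable lebesgue" unfolding D_def by measurable
    have "weighted_norm q s' (heat 1 f) \<le> Lq_norm q D"
      unfolding weighted_norm_def
    proof (intro Lq_norm_mono weight_measurable heat_measurable f mD)
      show "1 \<le> q" using pq by (rule order_trans)
      show "AE x in lebesgue. norm ((norm x powr s') *\<^sub>R heat 1 f x) \<le> norm (D x)"
        using AE_lebesgue_neq[of 0] by (rule eventually_mono) (rule le)
    qed
    also have "\<dots> \<le> ennreal C"
      unfolding D_def by (rule C(2)[OF mG G0 normG mV V0 v])
    finally show ?thesis using int by blast
  qed
  show ?thesis by (rule that[OF C(1)]) (use main in auto)
qed

section \<open>All times by scaling\<close>

lemma heat_kernel_dilation:
  fixes z :: "real^'n"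
  assumes "0 < t"
  shows "sqrt t ^ CARD('n) * heat_kernel t (sqrt t *\<^sub>R z) = heat_kernel 1 z"
proof -
  have "sqrt t ^ CARD('n) = t powr (real CARD('n) / 2)"
    using assms by (simp add: powr_half_sqrt[symmetric] powr_powr powr_realpow[symmetric])
  moreover have "t powr (real CARD('n) / 2) * t powr (- real CARD('n) / 2) = 1"
    using assms by (simp add: powr_add[symmetric])
  ultimately have "sqrt t ^ CARD('n) * (4 * pi * t) powr (- real CARD('n) / 2) = (4 * pi) powr (- real CARD('n) / 2)"
    using assms by (simp add: powr_mult)
  then show ?thesis
    using assms by (simp add: heat_kernel_def power_mult_distrib mult.assoc[symmetric])
qed

text \<open>
  The substitution \<open>y \<mapsto> sqrt t y\<close> turns time \<open>t\<close> into time 1. The amplitude \<open>N\<close> is carried along in order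
  to normalise \<open>f\<close> at the same time.
\<close>

lemma heat_dilation:
  fixes f :: "real^'n \<Rightarrow> 'a::euclidean_space"
  assumes t: "0 < t" and N: "N \<noteq> 0" and f: "f \<in> borel_measurable lebesgue"
  shows "heat t f x = N *\<^sub>R heat 1 (\<lambda>y. (1 / N) *\<^sub>R f (sqrt t *\<^sub>R y)) ((1 / sqrt t) *\<^sub>R x)"
    and "integrable lebesgue (\<lambda>y. heat_kernel 1 ((1 / sqrt t) *\<^sub>R x - y) *\<^sub>R ((1 / N) *\<^sub>R f (sqrt t *\<^sub>R y)))
      \<Longrightarrow> integrable lebesgue (\<lambda>y. heat_kernel t (x - y) *\<^sub>R f y)"
proof -
  let ?b = "sqrt t" and ?u = "\<lambda>y. heat_kernel t (x - y) *\<^sub>R f y"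
  let ?w = "\<lambda>y. heat_kernel 1 ((1 / ?b) *\<^sub>R x - y) *\<^sub>R ((1 / N) *\<^sub>R f (?b *\<^sub>R y))"
  have b: "0 < ?b" using t by simp
  have mu: "?u \<in> borel_measurable lebesgue"
    by (rule convolution_integrand_section_measurable[OF heat_kernel_measurable f])
  have eq: "?b ^ CARD('n) *\<^sub>R ?u (?b *\<^sub>R y) = N *\<^sub>R ?w y" for y
  proof -
    have "x - ?b *\<^sub>R y = ?b *\<^sub>R ((1 / ?b) *\<^sub>R x - y)" using b by (simp add: algebra_simps)
    then show ?thesis using heat_kernel_dilation[OF t, of "(1 / ?b) *\<^sub>R x - y"] N by simp
  qed
  have "heat t f x = ?b ^ CARD('n) *\<^sub>R (\<integral>y. ?u (?b *\<^sub>R y) \<partial>lebesgue)"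
    using integral_lebesgue_affine[of ?b ?u 0] mu b by (simp add: heat_def)
  also have "\<dots> = (\<integral>y. ?b ^ CARD('n) *\<^sub>R ?u (?b *\<^sub>R y) \<partial>lebesgue)" by (rule integral_scaleR_right[symmetric])
  also have "\<dots> = (\<integral>y. N *\<^sub>R ?w y \<partial>lebesgue)" by (simp only: eq)
  also have "\<dots> = N *\<^sub>R (\<integral>y. ?w y \<partial>lebesgue)" by (rule integral_scaleR_right)
  finally show "heat t f x = N *\<^sub>R heat 1 (\<lambda>y. (1 / N) *\<^sub>R f (?b *\<^sub>R y)) ((1 / ?b) *\<^sub>R x)" by (simp add: heat_def)
  assume w: "integrable lebesgue ?w"
  show "integrable lebesgue ?u"
  proof (rule integrableI_bounded[OF mu])
    have "integrable lebesgue (\<lambda>y. N *\<^sub>R ?w y)" by (intro integrable_scaleR_right w)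
    then have fin: "(\<integral>\<^sup>+y. ennreal (norm (?b ^ CARD('n) *\<^sub>R ?u (?b *\<^sub>R y))) \<partial>lebesgue) < \<infinity>"
      unfolding eq by (simp only: integrable_iff_bounded)
    have mub: "(\<lambda>y. ?u (?b *\<^sub>R y)) \<in> borel_measurable lebesgue"
      using measurable_compose[OF measurable_lebesgue_affine[of ?b 0] mu] b by simp
    have "(\<integral>\<^sup>+y. ennreal (norm (?u y)) \<partial>lebesgue)
        = ennreal (?b ^ CARD('n)) * (\<integral>\<^sup>+y. ennreal (norm (?u (?b *\<^sub>R y))) \<partial>lebesgue)"
      using nn_integral_lebesgue_affine[of ?b "\<lambda>y. ennreal (norm (?u y))" 0]
        measurable_compose[OF measurable_compose[OF mu borel_measurable_norm] measurable_ennreal] b by simp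
    also have "\<dots> = (\<integral>\<^sup>+y. ennreal (?b ^ CARD('n)) * ennreal (norm (?u (?b *\<^sub>R y))) \<partial>lebesgue)"
      by (rule nn_integral_cmult[symmetric])
        (rule measurable_compose[OF measurable_compose[OF mub borel_measurable_norm] measurable_ennreal])
    also have "\<dots> = (\<integral>\<^sup>+y. ennreal (norm (?b ^ CARD('n) *\<^sub>R ?u (?b *\<^sub>R y))) \<partial>lebesgue)"
      using b by (simp add: ennreal_mult'[symmetric] abs_mult mult.assoc)
    finally show "(\<integral>\<^sup>+y. ennreal (norm (?u y)) \<partial>lebesgue) < \<infinity>" using fin by simp
  qed
qed

text \<open>
  The dilation by \<open>sqrt t\<close> changes the two weighted norms by explicit powers of \<open>t\<close>, and the quotient of
  these powers is the factor in the estimate.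
\<close>

theorem weighted_heat_estimate:
  fixes p q :: ennreal
  assumes pq: "1 \<le> p" "p \<le> q" and adm: "admissible CARD('n) p q s s'"
  obtains C where "0 < C"
    "\<And>(f :: real^'n \<Rightarrow> 'a::euclidean_space) t. f \<in> weighted_L p s \<Longrightarrow> 0 < t \<Longrightarrow> heat_well_defined t f"
    "\<And>(f :: real^'n \<Rightarrow> 'a) t. f \<in> weighted_L p s \<Longrightarrow> 0 < t \<Longrightarrow> weighted_norm q s' (heat t f)
      \<le> ennreal (C * t powr (- (real CARD('n) / 2) * (recip p - recip q) - (s - s') / 2)) * weighted_norm p s f"
proof -
  obtain C where C: "0 < C"
    "\<And>f :: real^'n \<Rightarrow> 'a. f \<in> borel_measurable lebesgue \<Longrightarrow> weighted_norm p s f \<le> ennreal 1 \<Longrightarrow>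
      weighted_norm q s' (heat 1 f) \<le> ennreal C"
    "\<And>(f :: real^'n \<Rightarrow> 'a) x. f \<in> borel_measurable lebesgue \<Longrightarrow> weighted_norm p s f \<le> ennreal 1 \<Longrightarrow> x \<noteq> 0 \<Longrightarrow>
      integrable lebesgue (\<lambda>y. heat_kernel 1 (x - y) *\<^sub>R f y)"
    using heat_unit_time_bounded[OF assms, where 'a='a] by blast
  have q: "1 \<le> q" using pq by (rule order_trans)
  let ?d = "real CARD('n)"
  let ?e = "\<lambda>t. t powr (- (?d / 2) * (recip p - recip q) - (s - s') / 2)"
  have scaled: "heat_well_defined t f \<and> weighted_norm q s' (heat t f) \<le> ennreal (C * ?e t * N)"
    if f [measurable]: "f \<in> borel_measurable lebesgue" and t: "0 < t" and N: "0 < N" and le: "weighted_norm p s f \<le> ennreal N"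
    for f :: "real^'n \<Rightarrow> 'a" and t N
  proof -
    let ?b = "sqrt t"
    \<comment> \<open>The bound for the weighted norm of the dilated function, so that \<open>g\<close> has norm at most 1.\<close>
    define M where "M = N * ?b powr (- s - ?d * recip p)"
    have b: "0 < ?b" and M: "0 < M" using t N by (auto simp: M_def)
    define g where "g = (\<lambda>y. (1 / M) *\<^sub>R f (?b *\<^sub>R y))"
    have fb: "(\<lambda>y. f (?b *\<^sub>R y)) \<in> borel_measurable lebesgue"
      using measurable_compose[OF measurable_lebesgue_affine[of ?b 0] f] b by simp
    have mg: "g \<in> borel_measurable lebesgue" unfolding g_def using fb by measurable
    have "weighted_norm p s g \<le> ennreal (\<bar>1 / M\<bar> * ?b powr (- s - ?d * recip p) * N)"
      unfolding g_def using N by (intro weighted_norm_dilation_le pq b f le) simp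
    also have "\<bar>1 / M\<bar> * ?b powr (- s - ?d * recip p) * N = 1" using M N b by (simp add: M_def)
    finally have g1: "weighted_norm p s g \<le> ennreal 1" .
    have heat_eq: "heat t f = (\<lambda>x. M *\<^sub>R heat 1 g ((1 / ?b) *\<^sub>R x))"
      unfolding g_def using M by (intro ext heat_dilation(1) t f) simp
    have "weighted_norm q s' (heat t f) \<le> ennreal (\<bar>M\<bar> * (1 / ?b) powr (- s' - ?d * recip q) * C)"
      unfolding heat_eq using b C(1) by (intro weighted_norm_dilation_le q heat_measurable mg C(2) g1) auto
    also have "\<bar>M\<bar> * (1 / ?b) powr (- s' - ?d * recip q) * C = C * ?e t * N"
    proof -
      have "\<bar>M\<bar> * (1 / ?b) powr (- s' - ?d * recip q) = N * (?b powr (- s - ?d * recip p) * ?b powr (s' + ?d * recip q))"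
        using M b by (simp add: M_def powr_divide powr_minus_divide[symmetric] add.commute mult.commute)
      also have "?b powr (- s - ?d * recip p) * ?b powr (s' + ?d * recip q) = ?e t"
        using t by (simp add: powr_add[symmetric] powr_half_sqrt[symmetric] powr_powr field_simps)
      finally show ?thesis by simp
    qed
    finally have "weighted_norm q s' (heat t f) \<le> ennreal (C * ?e t * N)" .
    moreover have "heat_well_defined t f"
      unfolding heat_well_defined_def using AE_lebesgue_neq[of 0]
    proof eventually_elim
      case (elim x)
      then have "(1 / ?b) *\<^sub>R x \<noteq> 0" using b by simp
      from C(3)[OF mg g1 this] show ?case
        unfolding g_def using M by (intro heat_dilation(2)[OF t _ f]) auto
    qed
    ultimately show ?thesis by simp
  qed
  have main: "heat_well_defined t f \<and> weighted_norm q s' (heat t f) \<le> ennreal (C * ?e t) * weighted_norm p s f"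
    if f: "f \<in> weighted_L p s" and t: "0 < t" for f :: "real^'n \<Rightarrow> 'a" and t
  proof -
    have mf: "f \<in> borel_measurable lebesgue" using f by (simp add: weighted_L_def)
    have "weighted_norm p s f < top" using f by (simp add: weighted_L_def)
    then obtain n where n: "0 \<le> n" "weighted_norm p s f = ennreal n" using less_top_ennreal by blast
    have K: "0 < C * ?e t" using C(1) t by simp
    \<comment> \<open>Normalising by \<open>n\<close> itself would fail for \<open>n = 0\<close>, so the norm is enlarged by a small amount.\<close>
    have "weighted_norm q s' (heat t f) \<le> ennreal (C * ?e t) * weighted_norm p s f + ennreal e" if "0 < e" for e
    proof -
      have "0 < n + e / (C * ?e t)" using n K that by (intro add_nonneg_pos divide_pos_pos) auto
      moreover have "weighted_norm p s f \<le> ennreal (n + e / (C * ?e t))"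
        unfolding n(2) using K that by (intro ennreal_leI) (simp add: less_imp_le)
      ultimately have "weighted_norm q s' (heat t f) \<le> ennreal (C * ?e t * (n + e / (C * ?e t)))"
        using scaled[OF mf t] by blast
      also have "C * ?e t * (n + e / (C * ?e t)) = (C * ?e t) * n + e"
        using C(1) t by (simp add: distrib_left)
      also have "ennreal \<dots> = ennreal (C * ?e t) * weighted_norm p s f + ennreal e"
        unfolding n(2) using K n(1) that by (simp add: ennreal_mult ennreal_plus less_imp_le)
      finally show ?thesis .
    qed
    then have "weighted_norm q s' (heat t f) \<le> ennreal (C * ?e t) * weighted_norm p s f"
      by (rule ennreal_le_epsilon)
    moreover have "heat_well_defined t f"
      using scaled[OF mf t, of "n + 1"] n by (simp add: ennreal_leI)
    ultimately show ?thesis by simp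
  qed
  show ?thesis by (rule that[OF C(1)]) (use main in auto)
qed

section \<open>Bumps: the lower bound and the order of the weights are necessary\<close>

text \<open>
  Shells serve as sets of positive measure whenever an almost-everywhere statement has to be
  refuted.
\<close>

lemma not_AE_lebesgue_shell:
  assumes "0 < r" and "AE x in lebesgue. x \<notin> (shell r :: 'a::euclidean_space set)"
  shows False
proof -
  have "(shell r :: 'a set) \<in> null_sets lebesgue"
    using assms(2) AE_iff_null_sets[of "shell r :: 'a set" lebesgue] by simp
  then have "emeasure lborel (shell r :: 'a set) = 0" by (simp add: null_sets_def)
  moreover have "0 < shell_vol DIM('a) * r powr DIM('a)"
    using shell_vol_pos[of "DIM('a)"] assms(1) by simp
  ultimately show False using emeasure_shell[OF assms(1), where 'a='a] by (simp add: ennreal_eq_0_iff)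
qed

lemma Lq_norm_indicator:
  fixes B :: "(real^'n) set"
  assumes "1 \<le> q" "0 \<le> a" and B: "B \<in> sets borel" "emeasure lborel B = ennreal m" "0 < m"
  shows "Lq_norm q (\<lambda>x. a * indicator B x :: real) = ennreal (a * m powr recip q)"
  using assms(1)
proof (cases q rule: exponent_cases)
  case infinite
  have [measurable]: "B \<in> sets lebesgue" using B(1) by simp
  have meas: "(\<lambda>x. a * indicator B x :: real) \<in> borel_measurable lebesgue" by measurable
  have "Lq_norm top (\<lambda>x. a * indicator B x :: real) = ennreal a"
  proof (rule antisym)
    show "Lq_norm top (\<lambda>x. a * indicator B x :: real) \<le> ennreal a"
      using meas assms(2) by (subst Lq_norm_top_le_iff) (auto simp: indicator_def)
    show "ennreal a \<le> Lq_norm top (\<lambda>x. a * indicator B x :: real)"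
    proof (rule ccontr)
      assume "\<not> ennreal a \<le> Lq_norm top (\<lambda>x. a * indicator B x :: real)"
      then have less: "Lq_norm top (\<lambda>x. a * indicator B x :: real) < ennreal a" by simp
      have "AE x in lebesgue. ennreal (norm (a * indicator B x :: real)) \<le> Lq_norm top (\<lambda>x. a * indicator B x :: real)"
        unfolding Lq_norm_def by (simp add: esssup_AE)
      then have "AE x in lebesgue. x \<notin> B"
      proof eventually_elim
        case (elim x)
        show ?case
        proof
          assume "x \<in> B"
          with elim assms(2) have "ennreal a \<le> Lq_norm top (\<lambda>x. a * indicator B x :: real)" by simp
          with less show False by simp
        qed
      qed
      then have "B \<in> null_sets lebesgue" by (subst AE_iff_null_sets) measurable
      then have "emeasure lborel B = 0" using B(1) by (simp add: null_sets_def)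
      then show False using B by simp
    qed
  qed
  then show ?thesis using infinite B by simp
next
  case (finite r)
  have "(\<integral>\<^sup>+x. ennreal (norm (a * indicator B x :: real) powr r) \<partial>lebesgue)
      = (\<integral>\<^sup>+x. ennreal (a powr r) * indicator B x \<partial>lebesgue)"
    using assms(2) finite by (intro nn_integral_cong) (auto split: split_indicator)
  also have "\<dots> = ennreal (a powr r * m)"
    using B by (simp add: nn_integral_cmult_indicator ennreal_mult)
  finally have "Lq_norm q (\<lambda>x. a * indicator B x :: real) = ennreal ((a powr r * m) powr (1 / r))"
    using finite B unfolding Lq_norm_def by (simp add: Let_def)
  also have "(a powr r * m) powr (1 / r) = a * m powr (1 / r)"
    using finite assms(2) B by (simp add: powr_mult powr_powr)
  finally show ?thesis using finite by simp
qed

text \<open>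
  The test function for the conditions on \<open>s'\<close>, with values in the scalar field of the statement. For \<open>|c| \<ge> 2\<close> the ball stays away from the origin, so this function belongs to every
  weighted space.
\<close>

definition ball_bump :: "real^'n \<Rightarrow> real^'n \<Rightarrow> 'a::real_normed_field" where
  "ball_bump c x = of_real (indicator (cball c 1) x)"

lemma unit_ball_vol_card_pos: "0 < unit_ball_vol (real CARD('n::finite))"
  by simp

lemma emeasure_unit_ball: "emeasure lborel (cball (c :: real^'n) 1) = ennreal (unit_ball_vol (real CARD('n)))"
  by (simp add: emeasure_cball)

lemma ball_bump_measurable [measurable]:
  "(ball_bump c :: real^'n \<Rightarrow> 'a::{real_normed_field, second_countable_topology}) \<in> borel_measurable lebesgue"
  unfolding ball_bump_def[abs_def] by (intro measurable_completion) measurable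

lemma norm_comparable_on_ball:
  fixes c x :: "'a::real_normed_vector"
  assumes "2 \<le> norm c" "x \<in> cball c 1"
  shows "norm c / 2 \<le> norm x" "norm x \<le> 2 * norm c"
  using assms norm_triangle_ineq3[of c x] by (auto simp: dist_norm abs_le_iff)

lemma weighted_norm_ball_bump_le:
  fixes c :: "real^'n"
  assumes "1 \<le> p" "2 \<le> norm c"
  shows "weighted_norm p s (ball_bump c :: real^'n \<Rightarrow> 'a::{real_normed_field, second_countable_topology})
    \<le> ennreal (2 powr \<bar>s\<bar> * norm c powr s * unit_ball_vol (real CARD('n)) powr recip p)"
proof -
  let ?a = "2 powr \<bar>s\<bar> * norm c powr s"
  have [measurable]: "cball c 1 \<in> sets lebesgue" by simp
  have "weighted_norm p s (ball_bump c :: real^'n \<Rightarrow> 'a) \<le> Lq_norm p (\<lambda>x. ?a * indicator (cball c 1) x :: real)"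
    unfolding weighted_norm_def
  proof (intro Lq_norm_mono assms weight_measurable ball_bump_measurable AE_I2)
    show "(\<lambda>x. ?a * indicator (cball c 1) x) \<in> borel_measurable lebesgue" by measurable
    show "norm ((norm x powr s) *\<^sub>R (ball_bump c x :: 'a)) \<le> norm (?a * indicator (cball c 1) x :: real)" for x
    proof (cases "x \<in> cball c 1")
      case True
      have "norm x powr s \<le> ?a"
        using norm_comparable_on_ball[OF assms(2) True] assms(2) by (intro powr_comparable) linarith+
      with True show ?thesis by (simp add: ball_bump_def)
    qed (simp add: ball_bump_def)
  qed
  also have "\<dots> = ennreal (?a * unit_ball_vol (real CARD('n)) powr recip p)"
    by (rule Lq_norm_indicator[OF assms(1) _ _ emeasure_unit_ball unit_ball_vol_card_pos]) auto
  finally show ?thesis .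
qed

lemma ball_bump_in_weighted_L:
  fixes c :: "real^'n"
  assumes "1 \<le> p" "2 \<le> norm c"
  shows "(ball_bump c :: real^'n \<Rightarrow> 'a::{real_normed_field, second_countable_topology}) \<in> weighted_L p s"
  using weighted_norm_ball_bump_le[OF assms, of s, where 'a='a]
  by (auto simp: weighted_L_def intro: le_less_trans)

lemma heat_kernel_unit_ge:
  assumes "norm (z :: real^'n) \<le> r"
  shows "(4 * pi) powr (- real CARD('n) / 2) * exp (- r\<^sup>2 / 4) \<le> heat_kernel 1 z"
proof -
  have "(norm z)\<^sup>2 \<le> r\<^sup>2" using assms by (intro power_mono) auto
  then show ?thesis unfolding heat_kernel_unit by (intro mult_left_mono) auto
qed

lemma norm_heat_ball_bump_ge:
  fixes c x :: "real^'n"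
  assumes "\<And>y. y \<in> cball c 1 \<Longrightarrow> norm (x - y) \<le> r"
  shows "(4 * pi) powr (- real CARD('n) / 2) * exp (- r\<^sup>2 / 4) * unit_ball_vol (real CARD('n))
    \<le> norm (heat 1 (ball_bump c :: real^'n \<Rightarrow> 'a::{euclidean_space, real_normed_field}) x)"
proof -
  let ?k = "(4 * pi) powr (- real CARD('n) / 2)" and ?i = "indicator (cball c 1) :: real^'n \<Rightarrow> real"
  have fin: "emeasure lebesgue (cball c 1) < \<infinity>" by (simp add: emeasure_unit_ball)
  have i: "integrable lebesgue ?i" using fin by (intro integrable_real_indicator) simp_all
  have mi: "?i \<in> borel_measurable lebesgue" using i by (rule borel_measurable_integrable)
  have int: "integrable lebesgue (\<lambda>y. heat_kernel 1 (x - y) * ?i y)"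
  proof (rule Bochner_Integration.integrable_bound)
    show "integrable lebesgue (\<lambda>y. ?k * ?i y)" using i by simp
    show "(\<lambda>y. heat_kernel 1 (x - y) * ?i y) \<in> borel_measurable lebesgue"
      using convolution_integrand_section_measurable[OF heat_kernel_measurable mi, of 1 x] by simp
    show "AE y in lebesgue. norm (heat_kernel 1 (x - y) * ?i y) \<le> norm (?k * ?i y)"
      by (intro AE_I2) (auto simp: heat_kernel_unit mult_left_le split: split_indicator)
  qed
  have "heat 1 (ball_bump c :: real^'n \<Rightarrow> 'a) x = (\<integral>y. of_real (heat_kernel 1 (x - y) * ?i y) \<partial>lebesgue)"
    by (simp add: heat_def ball_bump_def scaleR_conv_of_real)
  also have "\<dots> = of_real (\<integral>y. heat_kernel 1 (x - y) * ?i y \<partial>lebesgue)" by (rule integral_of_real[OF int])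
  finally have heat: "norm (heat 1 (ball_bump c :: real^'n \<Rightarrow> 'a) x) = \<bar>\<integral>y. heat_kernel 1 (x - y) * ?i y \<partial>lebesgue\<bar>"
    by simp
  have "?k * exp (- r\<^sup>2 / 4) * unit_ball_vol (real CARD('n)) = (\<integral>y. ?k * exp (- r\<^sup>2 / 4) * ?i y \<partial>lebesgue)"
    using unit_ball_vol_card_pos[where 'n='n] by (simp add: measure_def emeasure_unit_ball)
  also have "\<dots> \<le> (\<integral>y. heat_kernel 1 (x - y) * ?i y \<partial>lebesgue)"
    using i int heat_kernel_unit_ge[OF assms]
    by (intro integral_mono) (auto split: split_indicator)
  finally show ?thesis unfolding heat by simp
qed

text \<open>
  The heat flow of a bump is bounded below by a positive constant \<open>\<delta>\<close> near the origin. Hence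
  \<open>\<delta> |x|^s'\<close> has to be in \<open>L^q\<close> of the unit ball.
\<close>

lemma lower_bound_necessary:
  fixes p q :: ennreal
  assumes pq: "1 \<le> p" "1 \<le> q"
    and est: "\<And>f :: real^'n \<Rightarrow> 'a::{euclidean_space, real_normed_field}. f \<in> weighted_L p s \<Longrightarrow>
      weighted_norm q s' (heat 1 f) < top"
  shows "if q = top then 0 \<le> s' else - real CARD('n) * recip q < s'"
proof -
  define c :: "real^'n" where "c = 2 *\<^sub>R axis undefined 1"
  have c: "norm c = 2" by (simp add: c_def)
  let ?f = "ball_bump c :: real^'n \<Rightarrow> 'a"
  \<comment> \<open>Points of the unit ball have distance at most 4 from the ball of radius 1 around \<open>c\<close>.\<close>
  define \<delta> where "\<delta> = (4 * pi) powr (- real CARD('n) / 2) * exp (- 4\<^sup>2 / 4) * unit_ball_vol (real CARD('n))"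
  have \<delta>: "0 < \<delta>" using unit_ball_vol_card_pos[where 'n='n] by (simp add: \<delta>_def)
  have ge: "\<delta> * norm x powr s' \<le> norm ((norm x powr s') *\<^sub>R heat 1 ?f x)" if "norm x \<le> 1" for x
  proof -
    have "norm (x - y) \<le> 4" if "y \<in> cball c 1" for y
      using norm_triangle_ineq4[of x y] norm_triangle_ineq3[of c y] \<open>norm x \<le> 1\<close> that c
      by (auto simp: dist_norm abs_le_iff)
    then have "\<delta> \<le> norm (heat 1 ?f x)" unfolding \<delta>_def by (rule norm_heat_ball_bump_ge)
    then have "\<delta> * norm x powr s' \<le> norm (heat 1 ?f x) * norm x powr s'" by (intro mult_right_mono) auto
    then show ?thesis by (simp add: mult.commute)
  qed
  have "weighted_norm q s' (heat 1 ?f) < top"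
    using c pq by (intro est ball_bump_in_weighted_L) auto
  then obtain K where K: "0 \<le> K" "weighted_norm q s' (heat 1 ?f) = ennreal K" using less_top_ennreal by blast
  have K': "Lq_norm q (\<lambda>x. (norm x powr s') *\<^sub>R heat 1 ?f x) \<le> ennreal K"
    using K(2) by (simp add: weighted_norm_def)
  have mh: "(\<lambda>x. (norm x powr s') *\<^sub>R heat 1 ?f x) \<in> borel_measurable lebesgue"
    by (intro weight_measurable heat_measurable ball_bump_measurable)
  show ?thesis
    using pq(2)
  proof (cases q rule: exponent_cases)
    case infinite
    have "0 \<le> s'"
    proof (rule ccontr)
      assume "\<not> 0 \<le> s'"
      then have s': "s' < 0" by simp
      \<comment> \<open>On the punctured ball of this radius \<open>\<delta> |x|^s'\<close> exceeds the supposed bound \<open>K\<close>.\<close>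
      define r where "r = min 1 (((K + 1) / \<delta>) powr (1 / s'))"
      have r: "0 < r" "r \<le> 1" using K \<delta> by (auto simp: r_def)
      have "AE x in lebesgue. norm ((norm x powr s') *\<^sub>R heat 1 ?f x) \<le> K"
        using K' infinite K(1) mh by (simp only: Lq_norm_top_le_iff)
      then have "AE x in lebesgue. x \<notin> (shell (r / 2) :: (real^'n) set)"
      proof eventually_elim
        case (elim x)
        show ?case
        proof
          assume "x \<in> shell (r / 2)"
          then have x: "r / 2 < norm x" "norm x \<le> r" by (auto simp: shell_def)
          then have "norm x \<le> ((K + 1) / \<delta>) powr (1 / s')" by (simp add: r_def)
          then have "(((K + 1) / \<delta>) powr (1 / s')) powr s' \<le> norm x powr s'"
            using s' x r by (intro powr_mono2') auto
          then have "(K + 1) / \<delta> \<le> norm x powr s'" using s' K \<delta> by (simp add: powr_powr)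
          then have "K + 1 \<le> \<delta> * norm x powr s'" using \<delta> by (simp add: divide_le_eq mult.commute)
          with ge[of x] elim x r show False by linarith
        qed
      qed
      then show False using r by (intro not_AE_lebesgue_shell[of "r / 2", where 'a="real^'n"]) auto
    qed
    with infinite show ?thesis by simp
  next
    case (finite Q)
    have "- real CARD('n) < s' * Q"
    proof (rule ccontr)
      assume "\<not> - real CARD('n) < s' * Q"
      then have inf: "(\<integral>\<^sup>+x. ennreal (norm x powr (s' * Q)) * indicator (cball 0 1 - {0}) x \<partial>(lborel :: (real^'n) measure)) = top"
        by (intro power_not_integrable_at_0) simp
      have "ennreal (\<delta> powr Q) * (\<integral>\<^sup>+x. ennreal (norm x powr (s' * Q)) * indicator (cball 0 1 - {0}) x \<partial>(lborel :: (real^'n) measure))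
        = (\<integral>\<^sup>+x. ennreal (\<delta> powr Q) * (ennreal (norm (x::real^'n) powr (s' * Q)) * indicator (cball 0 1 - {0}) x) \<partial>lborel)"
        by (rule nn_integral_cmult[symmetric]) measurable
      also have "\<dots> \<le> (\<integral>\<^sup>+x. ennreal (norm ((norm x powr s') *\<^sub>R heat 1 ?f x) powr Q) \<partial>lborel)"
      proof (rule nn_integral_mono)
        fix x :: "real^'n"
        have "(\<delta> * norm x powr s') powr Q \<le> norm ((norm x powr s') *\<^sub>R heat 1 ?f x) powr Q" if "norm x \<le> 1"
          using ge[OF that] \<delta> finite by (intro powr_mono2) auto
        then show "ennreal (\<delta> powr Q) * (ennreal (norm (x::real^'n) powr (s' * Q)) * indicator (cball 0 1 - {0}) x)
          \<le> ennreal (norm ((norm x powr s') *\<^sub>R heat 1 ?f x) powr Q)"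
          using \<delta> by (auto simp: powr_mult powr_powr ennreal_mult'[symmetric] intro!: ennreal_leI split: split_indicator)
      qed
      also have "\<dots> = (\<integral>\<^sup>+x. ennreal (norm ((norm x powr s') *\<^sub>R heat 1 ?f x) powr Q) \<partial>lebesgue)"
        by (rule nn_integral_completion[symmetric])
      also have "\<dots> \<le> ennreal (K powr Q)"
        using K' finite K(1) by (simp only: Lq_norm_finite_le_iff)
      finally show False unfolding inf using \<delta> by (simp add: ennreal_mult_top top_unique)
    qed
    then have "- real CARD('n) * (1 / Q) < s'" using finite(1) by (simp add: field_simps)
    with finite show ?thesis by simp
  qed
qed

text \<open>
  The dilation-invariance of the estimate hides any condition relating \<open>s\<close> and \<open>s'\<close>, so translations are
  used: for a bump at distance \<open>R\<close> from the origin, the left-hand side is of order \<open>R^s'\<close> and the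
  right-hand side of order \<open>R^s\<close>.
\<close>

lemma weight_order_necessary:
  fixes p q :: ennreal
  assumes pq: "1 \<le> p" "1 \<le> q"
    and est: "\<And>f :: real^'n \<Rightarrow> 'a::{euclidean_space, real_normed_field}. f \<in> weighted_L p s \<Longrightarrow>
      weighted_norm q s' (heat 1 f) \<le> ennreal C * weighted_norm p s f"
  shows "s' \<le> s"
proof (rule ccontr)
  assume "\<not> s' \<le> s"
  then have ss': "0 < s' - s" by simp
  let ?m = "unit_ball_vol (real CARD('n))"
  \<comment> \<open>Two points of a ball of radius 1 have distance at most 2.\<close>
  define \<delta> where "\<delta> = (4 * pi) powr (- real CARD('n) / 2) * exp (- 2\<^sup>2 / 4) * ?m"
  define L where "L = max C 0 * (2 powr \<bar>s\<bar> * ?m powr recip p)"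
  define K where "K = 2 powr - \<bar>s'\<bar> * \<delta> * ?m powr recip q"
  have \<delta>: "0 < \<delta>" using unit_ball_vol_card_pos[where 'n='n] by (simp add: \<delta>_def)
  have "?m \<noteq> 0" using unit_ball_vol_card_pos[where 'n='n] by linarith
  then have L: "0 \<le> L" and K: "0 < K" using \<delta> by (auto simp: L_def K_def)
  have growth: "K * R powr s' \<le> L * R powr s" if R: "2 \<le> R" for R
  proof -
    define c :: "real^'n" where "c = R *\<^sub>R axis undefined 1"
    have c: "norm c = R" using R by (simp add: c_def)
    let ?f = "ball_bump c :: real^'n \<Rightarrow> 'a"
    let ?a = "2 powr - \<bar>s'\<bar> * R powr s' * \<delta>"
    have [measurable]: "cball c 1 \<in> sets lebesgue" by simp
    have "ennreal (?a * ?m powr recip q) = Lq_norm q (\<lambda>x. ?a * indicator (cball c 1) x :: real)"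
      using \<delta> by (intro Lq_norm_indicator[OF pq(2) _ _ emeasure_unit_ball unit_ball_vol_card_pos, symmetric]) auto
    also have "\<dots> \<le> weighted_norm q s' (heat 1 ?f)"
      unfolding weighted_norm_def
    proof (intro Lq_norm_mono pq weight_measurable heat_measurable ball_bump_measurable AE_I2)
      show "(\<lambda>x. ?a * indicator (cball c 1) x) \<in> borel_measurable lebesgue" by measurable
      fix x :: "real^'n"
      show "norm (?a * indicator (cball c 1) x :: real) \<le> norm ((norm x powr s') *\<^sub>R heat 1 ?f x)"
      proof (cases "x \<in> cball c 1")
        case True
        have "norm (x - y) \<le> 2" if "y \<in> cball c 1" for y
          using dist_triangle[of x y c] True that by (simp add: dist_norm norm_minus_commute)
        then have "\<delta> \<le> norm (heat 1 ?f x)" unfolding \<delta>_def by (rule norm_heat_ball_bump_ge)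
        moreover have "2 powr - \<bar>s'\<bar> * R powr s' \<le> norm x powr s'"
          using norm_comparable_on_ball[of c x] True R c by (intro powr_comparable) auto
        ultimately have "?a \<le> norm x powr s' * norm (heat 1 ?f x)" using \<delta> by (intro mult_mono) auto
        with True \<delta> show ?thesis by simp
      qed simp
    qed
    also have "\<dots> \<le> ennreal C * weighted_norm p s ?f"
      using c R pq by (intro est ball_bump_in_weighted_L) auto
    also have "\<dots> \<le> ennreal (max C 0) * ennreal (2 powr \<bar>s\<bar> * R powr s * ?m powr recip p)"
      using weighted_norm_ball_bump_le[OF pq(1), of c s, where 'a='a] c R
      by (intro mult_mono ennreal_leI) auto
    also have "\<dots> = ennreal (L * R powr s)" by (simp add: L_def ennreal_mult'[symmetric] mult_ac)
    finally show ?thesis using L by (subst (asm) ennreal_le_iff) (auto simp: K_def mult_ac)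
  qed
  \<comment> \<open>Large enough for \<open>R^(s'-s)\<close> to exceed \<open>L/K\<close>.\<close>
  define R where "R = max 2 ((L / K + 1) powr (1 / (s' - s)))"
  have R: "2 \<le> R" by (simp add: R_def)
  have "L / K + 1 = ((L / K + 1) powr (1 / (s' - s))) powr (s' - s)" using ss' L K by (simp add: powr_powr)
  also have "\<dots> \<le> R powr (s' - s)" using ss' by (intro powr_mono2) (auto simp: R_def)
  also have "R powr (s' - s) = R powr s' / R powr s" using R by (simp add: powr_diff)
  also have "\<dots> \<le> L / K" using growth[OF R] K R by (simp add: divide_simps mult.commute)
  finally show False by simp
qed

section \<open>A critical singularity: the upper bound is necessary\<close>

text \<open>
  The power \<open>|x|^(-d)\<close> just fails to be integrable at the origin, and it still does after the division by
  the logarithm, which makes the function belong to \<open>L^p_s\<close> even at the endpoint \<open>s = d (1 - 1/p)\<close> for \<open>p > 1\<close>; so one function rules out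
  every \<open>s\<close> that violates the upper bound.
\<close>

definition critical_profile :: "'a::euclidean_space \<Rightarrow> real" where
  "critical_profile x =
    indicator (cball 0 1 - {0}) x * (norm x powr - real DIM('a) / (1 - log 2 (norm x)))"

lemma critical_profile_measurable [measurable]: "critical_profile \<in> borel_measurable borel"
  unfolding critical_profile_def[abs_def] by measurable

lemma log_norm_dyadic:
  fixes x :: real
  assumes "(1/2) ^ Suc k < x" "x \<le> (1/2) ^ k"
  shows "real (Suc k) \<le> 1 - log 2 x" "1 - log 2 x \<le> real (k + 2)"
proof -
  have x: "0 < x" using assms(1) by (rule less_trans[rotated]) simp
  have half: "log 2 ((1/2) ^ n) = - real n" for n
    by (simp add: log_nat_power log_divide)
  have "log 2 x \<le> log 2 ((1/2) ^ k)" using assms x by (subst log_le_cancel_iff) auto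
  then show "real (Suc k) \<le> 1 - log 2 x" unfolding half by simp
  have "log 2 ((1/2) ^ Suc k) \<le> log 2 x" using assms x by (subst log_le_cancel_iff) auto
  then show "1 - log 2 x \<le> real (k + 2)" unfolding half by simp
qed

lemma critical_profile_nonneg [simp]: "0 \<le> critical_profile x"
proof (cases "x \<in> cball 0 1 - {0}")
  case True
  then have "log 2 (norm x) \<le> log 2 1" by (subst log_le_cancel_iff) auto
  with True show ?thesis by (simp add: critical_profile_def)
qed (simp add: critical_profile_def)

lemma mem_dyadic_shell:
  assumes "x \<in> shell ((1/2) ^ Suc k)"
  shows "x \<in> cball 0 1 - {0}" "(1/2) ^ Suc k < norm x" "norm x \<le> (1/2) ^ k"
proof -
  show *: "(1/2) ^ Suc k < norm x" "norm x \<le> (1/2) ^ k" using assms by (auto simp: shell_def)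
  have "(1/2 :: real) ^ k \<le> 1" by (rule power_le_one) auto
  moreover have "0 < norm x" using *(1) by (rule less_trans[rotated]) simp
  ultimately show "x \<in> cball 0 1 - {0}" using *(2) by auto
qed

text \<open>
  The shell with index \<open>k\<close> contributes at least a multiple of \<open>1/(k+2)\<close>.
\<close>

lemma critical_profile_not_integrable:
  "(\<integral>\<^sup>+x. ennreal (critical_profile x) \<partial>(lborel :: 'a::euclidean_space measure)) = top"
proof -
  let ?d = "real DIM('a)"
  let ?c = "2 powr - ?d * shell_vol DIM('a)"
  have c: "0 < ?c" using shell_vol_pos[of "DIM('a)"] by auto
  have "\<not> summable (\<lambda>k. inverse (real (k + 2)))"
    using not_summable_harmonic[where 'a=real] summable_iff_shift[of "\<lambda>n. inverse (real n)" 2] by simp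
  then have "\<not> summable (\<lambda>k. ?c * inverse (real (k + 2)))"
    using c summable_cmult_iff[of ?c "\<lambda>k. inverse (real (k + 2))"] by auto
  moreover have "ennreal (?c * inverse (real (k + 2)))
      \<le> (\<integral>\<^sup>+x. ennreal (critical_profile x) * indicator (shell ((1/2) ^ Suc k)) x \<partial>(lborel :: 'a measure))" for k
  proof -
    let ?r = "(1/2) ^ Suc k :: real"
    have "?c * inverse (real (k + 2)) = (2 powr - ?d * ?r powr - ?d * inverse (real (k + 2))) * (shell_vol DIM('a) * ?r powr ?d)"
    proof -
      have "?r powr - ?d * ?r powr ?d = 1" by (simp add: powr_add[symmetric])
      moreover have "(2 powr - ?d * ?r powr - ?d * inverse (real (k + 2))) * (shell_vol DIM('a) * ?r powr ?d)
          = ?c * inverse (real (k + 2)) * (?r powr - ?d * ?r powr ?d)"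
        by (simp only: mult_ac)
      ultimately show ?thesis by simp
    qed
    also have "ennreal \<dots> \<le> (\<integral>\<^sup>+x. ennreal (critical_profile x) * indicator (shell ?r) x \<partial>(lborel :: 'a measure))"
    proof (intro nn_integral_shell_ge ennreal_leI)
      fix x :: 'a assume "x \<in> shell ?r"
      note x = mem_dyadic_shell[OF this]
      note l = log_norm_dyadic[OF x(2,3)]
      have "2 powr - \<bar>- ?d\<bar> * ?r powr - ?d \<le> norm x powr - ?d"
        using x by (intro powr_comparable) auto
      moreover have "inverse (real (k + 2)) \<le> inverse (1 - log 2 (norm x))"
        using l by (intro le_imp_inverse_le) auto
      ultimately have "2 powr - \<bar>- ?d\<bar> * ?r powr - ?d * inverse (real (k + 2))
          \<le> norm x powr - ?d * inverse (1 - log 2 (norm x))"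
        by (intro mult_mono) auto
      then show "2 powr - ?d * ?r powr - ?d * inverse (real (k + 2)) \<le> critical_profile x"
        unfolding critical_profile_def indicator_simps(1)[OF x(1)] by (simp only: mult_1 divide_inverse abs_minus_cancel abs_of_nat)
    qed auto
    finally show ?thesis .
  qed
  moreover have "0 \<le> ?c * inverse (real (k + 2))" for k using c by simp
  ultimately have "(\<Sum>k. \<integral>\<^sup>+x. ennreal (critical_profile x) * indicator (shell ((1/2) ^ Suc k)) x \<partial>(lborel :: 'a measure)) = top"
    by (intro suminf_ge_ennreal_infinite[of "\<lambda>k. ?c * inverse (real (k + 2))"])
  then have "(\<integral>\<^sup>+x. ennreal (critical_profile x) * indicator (cball 0 1 - {0}) x \<partial>(lborel :: 'a measure)) = top"
    by (subst nn_integral_inner_shells) measurable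
  moreover have "(\<integral>\<^sup>+x. ennreal (critical_profile x) * indicator (cball 0 1 - {0}) x \<partial>(lborel :: 'a measure))
      \<le> (\<integral>\<^sup>+x. ennreal (critical_profile x) \<partial>(lborel :: 'a measure))"
    by (intro nn_integral_mono) (auto split: split_indicator)
  ultimately show ?thesis by (simp add: top_unique)
qed

text \<open>
  The series that bounds the weighted norm of the critical profile: for \<open>r > 1\<close> the power of \<open>k\<close> makes it
  converge even if \<open>e = 0\<close>, for \<open>r = 1\<close> the geometric factor is needed.
\<close>

lemma summable_log_geometric:
  fixes r e :: real
  assumes "1 \<le> r" "0 \<le> e" "r = 1 \<Longrightarrow> 0 < e"
  shows "summable (\<lambda>k. ((1/2) ^ Suc k) powr e * real (Suc k) powr - r)"
proof -
  have norm_eq: "norm (((1/2) ^ Suc k) powr e * real (Suc k) powr - r) = ((1/2) ^ Suc k) powr e * real (Suc k) powr - r" for k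
    by (simp only: real_norm_def abs_of_nonneg[OF mult_nonneg_nonneg[OF powr_ge_zero powr_ge_zero]])
  show ?thesis
  proof (cases "r = 1")
    case True
    let ?\<rho> = "(1/2) powr e"
    have "?\<rho> < 1" using assms True powr_less_mono2[of e "1/2" 1] by simp
    then have sum: "summable (\<lambda>k. ?\<rho> ^ Suc k)"
      by (intro summable_Suc_iff[THEN iffD2] summable_geometric) auto
    have bd: "((1/2) ^ Suc k) powr e * real (Suc k) powr - r \<le> ?\<rho> ^ Suc k" for k
    proof -
      have "real (Suc k) powr - r \<le> real (Suc k) powr 0" using assms by (intro powr_mono) auto
      then have "((1/2) ^ Suc k) powr e * real (Suc k) powr - r \<le> ((1/2) ^ Suc k) powr e * 1"
        by (intro mult_left_mono) auto
      also have "\<dots> = ?\<rho> ^ Suc k" using powr_power_commute[of "1/2" "Suc k" e] by simp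
      finally show ?thesis .
    qed
    show ?thesis
      by (rule summable_comparison_test'[OF sum, of 0]) (subst norm_eq, rule bd)
  next
    case False
    then have "summable (\<lambda>n. real n powr - r)" using assms by (simp add: summable_real_powr_iff)
    then have sum: "summable (\<lambda>n. real (Suc n) powr - r)" using summable_Suc_iff[of "\<lambda>n. real n powr - r"] by blast
    have bd: "((1/2) ^ Suc k) powr e * real (Suc k) powr - r \<le> real (Suc k) powr - r" for k
    proof -
      have "(1/2 :: real) ^ Suc k \<le> 1" by (rule power_le_one) auto
      then have "((1/2 :: real) ^ Suc k) powr e \<le> 1" using assms(2) by (intro powr_le1) auto
      then show ?thesis by (intro mult_left_le_one_le) auto
    qed
    show ?thesis
      by (rule summable_comparison_test'[OF sum, of 0]) (subst norm_eq, rule bd)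
  qed
qed

lemma critical_profile_weighted_norm_finite:
  fixes p :: ennreal
  assumes p: "1 \<le> p" and s: "\<not> (if p = 1 then s \<le> 0 else s < real CARD('n) * (1 - recip p))"
  shows "weighted_norm p s (\<lambda>x::real^'n. of_real (critical_profile x) :: 'a::{real_normed_field, second_countable_topology}) < top"
proof -
  let ?d = "real CARD('n)" and ?f = "\<lambda>x::real^'n. of_real (critical_profile x) :: 'a"
  have mf: "?f \<in> borel_measurable lebesgue" by (intro measurable_completion) measurable
  have norm_eq: "norm ((norm x powr s) *\<^sub>R ?f x) = norm x powr s * critical_profile x" for x by simp
  show ?thesis
    using p
  proof (cases p rule: exponent_cases)
    case infinite
    with s have sd: "?d \<le> s" by simp
    have "norm ((norm x powr s) *\<^sub>R ?f x) \<le> 1" for x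
    proof (cases "x \<in> cball 0 1 - {0}")
      case True
      then have "log 2 (norm x) \<le> log 2 1" by (subst log_le_cancel_iff) auto
      then have "norm x powr s * critical_profile x \<le> norm x powr s * (norm x powr - ?d / 1)"
      proof (intro mult_left_mono)
        have "1 \<le> 1 - log 2 (norm x)" using \<open>log 2 (norm x) \<le> log 2 1\<close> by simp
        then have "norm x powr - ?d / (1 - log 2 (norm x)) \<le> norm x powr - ?d / 1"
          by (intro divide_left_mono) auto
        with True show "critical_profile x \<le> norm x powr - ?d / 1" by (simp add: critical_profile_def)
      qed simp
      also have "\<dots> = norm x powr (s - ?d)" using True by (simp add: powr_add[symmetric])
      also have "\<dots> \<le> 1" using True sd by (intro powr_le1) auto
      finally show ?thesis by (simp only: norm_eq)
    qed (simp add: critical_profile_def)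
    then have "Lq_norm top (\<lambda>x. (norm x powr s) *\<^sub>R ?f x) \<le> ennreal 1"
      using mf by (subst Lq_norm_top_le_iff) auto
    then show ?thesis using infinite by (auto simp: weighted_norm_def intro: le_less_trans)
  next
    case (finite r)
    \<comment> \<open>The shell of radius \<open>\<rho>\<close> contributes \<open>\<rho>^e\<close> up to the logarithmic factor; \<open>s \<ge> d (1 - 1/r)\<close> says
      that \<open>e \<ge> 0\<close>.\<close>
    define e where "e = (s - ?d) * r + ?d"
    have e: "0 \<le> e" "r = 1 \<Longrightarrow> 0 < e"
    proof -
      show "0 < e" if "r = 1" using that finite s by (simp add: e_def)
      show "0 \<le> e"
      proof (cases "p = 1")
        case True
        then show ?thesis using finite s by (simp add: e_def)
      next
        case False
        then have "?d * (1 - 1 / r) \<le> s" using finite s by simp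
        then have "?d * (1 - 1 / r) * r \<le> s * r" using finite by (intro mult_right_mono) auto
        then show ?thesis using finite by (simp add: e_def algebra_simps)
      qed
    qed
    let ?u = "\<lambda>x. ennreal (norm ((norm x powr s) *\<^sub>R ?f x) powr r)"
    let ?c = "2 powr \<bar>(s - ?d) * r\<bar> * shell_vol CARD('n)"
    let ?g = "\<lambda>k. ?c * (((1/2) ^ Suc k) powr e * real (Suc k) powr - r)"
    have c: "0 \<le> ?c" using shell_vol_pos[of "CARD('n)"] by auto
    have "(\<integral>\<^sup>+x. ?u x \<partial>lebesgue) = (\<integral>\<^sup>+x. ?u x \<partial>lborel)" by (rule nn_integral_completion)
    also have "\<dots> = (\<integral>\<^sup>+x. ?u x * indicator (cball 0 1 - {0}) x \<partial>lborel)"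
      by (intro nn_integral_cong) (auto simp: critical_profile_def split: split_indicator)
    also have "\<dots> = (\<Sum>k. \<integral>\<^sup>+x. ?u x * indicator (shell ((1/2) ^ Suc k)) x \<partial>lborel)"
      by (rule nn_integral_inner_shells) measurable
    also have "\<dots> < top"
    proof (rule suminf_le_ennreal_finite)
      show "summable ?g" by (intro summable_mult summable_log_geometric e finite)
      show "0 \<le> ?g k" for k using c by simp
      fix k
      let ?r = "(1/2) ^ Suc k :: real"
      have "(\<integral>\<^sup>+x. ?u x * indicator (shell ?r) x \<partial>lborel)
        \<le> ennreal ((2 powr \<bar>(s - ?d) * r\<bar> * ?r powr ((s - ?d) * r) * real (Suc k) powr - r) * (shell_vol DIM(real^'n) * ?r powr DIM(real^'n)))"
      proof (intro nn_integral_shell_le ennreal_leI)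
        fix x :: "real^'n" assume "x \<in> shell ?r"
        note x = mem_dyadic_shell[OF this]
        note l = log_norm_dyadic[OF x(2,3)]
        have "norm ((norm x powr s) *\<^sub>R ?f x) = norm x powr (s - ?d) / (1 - log 2 (norm x))"
          unfolding norm_eq using x(1) by (simp add: critical_profile_def powr_diff powr_minus_divide)
        then have "norm ((norm x powr s) *\<^sub>R ?f x) powr r = norm x powr ((s - ?d) * r) * (1 - log 2 (norm x)) powr - r"
          using l(1) by (simp add: powr_divide powr_powr powr_minus_divide)
        also have "\<dots> \<le> (2 powr \<bar>(s - ?d) * r\<bar> * ?r powr ((s - ?d) * r)) * real (Suc k) powr - r"
          using x l(1) finite by (intro mult_mono powr_comparable powr_mono2') auto
        finally show "norm ((norm x powr s) *\<^sub>R ?f x) powr r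
          \<le> 2 powr \<bar>(s - ?d) * r\<bar> * ?r powr ((s - ?d) * r) * real (Suc k) powr - r" .
      qed auto
      also have "(2 powr \<bar>(s - ?d) * r\<bar> * ?r powr ((s - ?d) * r) * real (Suc k) powr - r) * (shell_vol DIM(real^'n) * ?r powr DIM(real^'n)) = ?g k"
        by (simp add: e_def powr_add mult_ac)
      finally show "(\<integral>\<^sup>+x. ?u x * indicator (shell ?r) x \<partial>lborel) \<le> ennreal (?g k)" .
    qed
    finally have "(\<integral>\<^sup>+x. ?u x \<partial>lebesgue) \<noteq> top" by simp
    then show ?thesis using finite by (simp add: weighted_norm_def Lq_norm_def Let_def)
  qed
qed

text \<open>
  The heat kernel is bounded below on the unit ball, so the convolution integral diverges at every
  point.
\<close>

lemma heat_critical_profile_undefined: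
  "\<not> heat_well_defined 1 (\<lambda>x::real^'n. of_real (critical_profile x) :: 'a::{euclidean_space, real_normed_field})"
proof
  let ?f = "\<lambda>x::real^'n. of_real (critical_profile x) :: 'a"
  have never: "\<not> integrable lebesgue (\<lambda>y. heat_kernel 1 (x - y) *\<^sub>R ?f y)" for x
  proof
    assume "integrable lebesgue (\<lambda>y. heat_kernel 1 (x - y) *\<^sub>R ?f y)"
    then have fin: "(\<integral>\<^sup>+y. ennreal (norm (heat_kernel 1 (x - y) *\<^sub>R ?f y)) \<partial>lebesgue) < top"
      by (simp only: integrable_iff_bounded infinity_ennreal_def)
    define k where "k = (4 * pi) powr (- real CARD('n) / 2) * exp (- (norm x + 1)\<^sup>2 / 4)"
    have k: "0 < k" by (simp add: k_def)
    have "ennreal k * (\<integral>\<^sup>+y. ennreal (critical_profile y) \<partial>(lborel :: (real^'n) measure))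
      = (\<integral>\<^sup>+y. ennreal k * ennreal (critical_profile y) \<partial>(lborel :: (real^'n) measure))"
      by (rule nn_integral_cmult[symmetric]) measurable
    also have "\<dots> \<le> (\<integral>\<^sup>+y. ennreal (norm (heat_kernel 1 (x - y) *\<^sub>R ?f y)) \<partial>lborel)"
    proof (rule nn_integral_mono)
      fix y :: "real^'n"
      have "k * critical_profile y \<le> heat_kernel 1 (x - y) * critical_profile y"
      proof (cases "y \<in> cball 0 1 - {0}")
        case True
        then have "norm (x - y) \<le> norm x + 1" using norm_triangle_ineq4[of x y] by simp
        then show ?thesis unfolding k_def by (intro mult_right_mono heat_kernel_unit_ge) auto
      qed (simp add: critical_profile_def)
      then show "ennreal k * ennreal (critical_profile y) \<le> ennreal (norm (heat_kernel 1 (x - y) *\<^sub>R ?f y))"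
        using k by (simp add: ennreal_mult'[symmetric] ennreal_leI)
    qed
    also have "\<dots> = (\<integral>\<^sup>+y. ennreal (norm (heat_kernel 1 (x - y) *\<^sub>R ?f y)) \<partial>lebesgue)"
      by (rule nn_integral_completion[symmetric])
    finally have "ennreal k * top \<le> (\<integral>\<^sup>+y. ennreal (norm (heat_kernel 1 (x - y) *\<^sub>R ?f y)) \<partial>lebesgue)"
      unfolding critical_profile_not_integrable .
    then have "ennreal k * top < top" using fin by (rule le_less_trans)
    then show False using k by (simp add: ennreal_mult_top)
  qed
  assume "heat_well_defined 1 ?f"
  then have "AE x in (lebesgue :: (real^'n) measure). False"
    unfolding heat_well_defined_def by (rule eventually_mono) (use never in blast)
  then have "AE x in lebesgue. x \<notin> (shell 1 :: (real^'n) set)" by (rule eventually_mono) simp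
  then show False by (rule not_AE_lebesgue_shell[rotated]) simp
qed

lemma upper_bound_necessary:
  fixes p :: ennreal
  assumes "1 \<le> p"
    and est: "\<And>f :: real^'n \<Rightarrow> 'a::{euclidean_space, real_normed_field}. f \<in> weighted_L p s \<Longrightarrow> heat_well_defined 1 f"
  shows "if p = 1 then s \<le> 0 else s < real CARD('n) * (1 - recip p)"
proof (rule ccontr)
  let ?f = "\<lambda>x::real^'n. of_real (critical_profile x) :: 'a"
  assume "\<not> ?thesis"
  then have "weighted_norm p s ?f < top" by (rule critical_profile_weighted_norm_finite[OF assms(1)])
  moreover have "?f \<in> borel_measurable lebesgue" by (intro measurable_completion) measurable
  ultimately have "heat_well_defined 1 ?f" by (intro est) (simp add: weighted_L_def)
  then show False using heat_critical_profile_undefined by blast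
qed

section \<open>The sharp weighted estimate\<close>

theorem lemma2p1:
  fixes p q :: ennreal and s s' :: real
  assumes "1 \<le> p" and "p \<le> q"
  shows
    "(admissible CARD('n::finite) p q s s' \<longrightarrow>
       (\<exists>C>0. \<forall>f \<in> (weighted_L p s :: (real^'n \<Rightarrow> 'a::{euclidean_space, real_normed_field}) set). \<forall>t>0.
          heat_well_defined t f \<and>
          weighted_norm q s' (heat t f)
            \<le> ennreal (C * t powr (- (real CARD('n) / 2) * (recip p - recip q) - (s - s') / 2))
                * weighted_norm p s f))
     \<and>
     (\<not> admissible CARD('n) p q s s' \<longrightarrow>
       \<not> (\<exists>C. \<forall>f \<in> (weighted_L p s :: (real^'n \<Rightarrow> 'a) set). \<forall>t>0.
          heat_well_defined t f \<and>
          weighted_norm q s' (heat t f)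
            \<le> ennreal (C * t powr (- (real CARD('n) / 2) * (recip p - recip q) - (s - s') / 2))
                * weighted_norm p s f))"
proof (intro conjI impI notI)
  assume "admissible CARD('n) p q s s'"
  then obtain C where C: "0 < C"
    "\<And>(f :: real^'n \<Rightarrow> 'a) t. f \<in> weighted_L p s \<Longrightarrow> 0 < t \<Longrightarrow> heat_well_defined t f"
    "\<And>(f :: real^'n \<Rightarrow> 'a) t. f \<in> weighted_L p s \<Longrightarrow> 0 < t \<Longrightarrow> weighted_norm q s' (heat t f)
      \<le> ennreal (C * t powr (- (real CARD('n) / 2) * (recip p - recip q) - (s - s') / 2)) * weighted_norm p s f"
    using weighted_heat_estimate[OF assms, where 'a='a and 'n='n] by blast
  then show "\<exists>C>0. \<forall>f \<in> (weighted_L p s :: (real^'n \<Rightarrow> 'a) set). \<forall>t>0.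
          heat_well_defined t f \<and>
          weighted_norm q s' (heat t f)
            \<le> ennreal (C * t powr (- (real CARD('n) / 2) * (recip p - recip q) - (s - s') / 2))
                * weighted_norm p s f"
    by blast
next
  assume not_adm: "\<not> admissible CARD('n) p q s s'"
  assume "\<exists>C. \<forall>f \<in> (weighted_L p s :: (real^'n \<Rightarrow> 'a) set). \<forall>t>0.
          heat_well_defined t f \<and>
          weighted_norm q s' (heat t f)
            \<le> ennreal (C * t powr (- (real CARD('n) / 2) * (recip p - recip q) - (s - s') / 2))
                * weighted_norm p s f"
  then obtain C where "\<And>(f :: real^'n \<Rightarrow> 'a) t. f \<in> weighted_L p s \<Longrightarrow> 0 < t \<Longrightarrow>
      heat_well_defined t f \<and> weighted_norm q s' (heat t f)
        \<le> ennreal (C * t powr (- (real CARD('n) / 2) * (recip p - recip q) - (s - s') / 2)) * weighted_norm p s f"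
    by blast
  from this[of _ 1] have est: "heat_well_defined 1 f" "weighted_norm q s' (heat 1 f) \<le> ennreal C * weighted_norm p s f"
    if "f \<in> weighted_L p s" for f :: "real^'n \<Rightarrow> 'a"
    using that by auto
  have q: "1 \<le> q" using assms by (rule order_trans)
  have fin: "weighted_norm q s' (heat 1 f) < top" if f: "f \<in> weighted_L p s" for f :: "real^'n \<Rightarrow> 'a"
  proof -
    have "weighted_norm p s f < top" using f by (simp add: weighted_L_def)
    then have "ennreal C * weighted_norm p s f < top" by (simp add: ennreal_mult_less_top)
    with est(2)[OF f] show ?thesis by (rule le_less_trans)
  qed
  have "admissible CARD('n) p q s s'"
    unfolding admissible_def
  proof (intro conjI)
    show "if q = top then 0 \<le> s' else - real CARD('n) * recip q < s'"
      by (rule lower_bound_necessary[OF assms(1) q]) (rule fin)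
    show "s' \<le> s" by (rule weight_order_necessary[OF assms(1) q]) (rule est(2))
    show "if p = 1 then s \<le> 0 else s < real CARD('n) * (1 - recip p)"
      by (rule upper_bound_necessary[OF assms(1)]) (rule est(1))
  qed
  with not_adm show False ..
qed

end
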